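(* Let $\{\mathcal{T}(t)\}_{t\ge 0}$ be the asymmetric telegraph process with velocities $c_1,-c_2$ ($c_1,c_2>0$) and rate $\lambda>0$, and let $t>0$. For every $\beta\in[0,c_1t]$, $$P\Big\{\max_{0\le s\le t}\mathcal{T}(s)\le\beta\ \Big|\ V(0)=-c_2\Big\}=e^{-\lambda t}\left[\sum_{r=0}^{\infty}I_r\Big(\frac{2\lambda}{c_1+c_2}\sqrt{(c_1t-\beta)(c_2t+\beta)}\Big)\left(\sqrt{\frac{c_2t+\beta}{c_1t-\beta}}\right)^{r}-\sum_{r=2}^{\infty}I_r\Big(\frac{2\lambda}{c_1+c_2}\sqrt{(c_1t-\beta)(c_2t+\beta)}\Big)\Big(\frac{c_2}{c_1}\Big)^{r-1}\left(\sqrt{\frac{c_1t-\beta}{c_2t+\beta}}\right)^{r}\right].$$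
   Context: Asymmetric telegraph process: let $c_1,c_2>0$, $\lambda>0$. Let $\{N(t)\}_{t\ge0}$ be a homogeneous Poisson process with rate $\lambda$, and let $V(0)$ be a random variable independent of $N$ with $P\{V(0)=c_1\}=P\{V(0)=-c_2\}=\frac12$. The velocity $V(s)$ takes values in $\{c_1,-c_2\}$, starts at $V(0)$, and switches from one of these two values to the other at each event of $N$, remaining constant between events. The position of the particle is $\mathcal{T}(t)=\int_0^t V(s)\,ds$ (so $\mathcal{T}(0)=0$). $I_r$ is the modified Bessel function $I_r(x)=\sum_{j=0}^{\infty}\left(\frac{x}{2}\right)^{2j+r}\frac{1}{j!\,\Gamma(j+r+1)}$. At the endpoint $\beta=c_1t$ each term of the series is understood as its limit as $\beta\uparrow c_1t$. *)

theory Defs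
  imports "HOL-Probability.Probability"
begin

text \<open>
  Homogeneous Poisson process as a counting process. The path conditions hold for every outcome,
  and \<open>N s\<close> for \<open>s < 0\<close> is unconstrained. By monotonicity the truncated subtraction on
  \<^typ>\<open>nat\<close> is the true increment.
\<close>

definition poisson_process :: "'a measure \<Rightarrow> real \<Rightarrow> (real \<Rightarrow> 'a \<Rightarrow> nat) \<Rightarrow> bool" where
  "poisson_process M lam N \<longleftrightarrow>
     (\<forall>s\<ge>0. N s \<in> measurable M (count_space UNIV)) \<and>
     (\<forall>\<omega>\<in>space M. N 0 \<omega> = 0 \<and> mono_on {0..} (\<lambda>s. N s \<omega>) \<and>
        (\<forall>s\<ge>0. continuous (at_right s) (\<lambda>u. N u \<omega>))) \<and>
     (\<forall>s u. 0 \<le> s \<and> s < u \<longrightarrow>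
        distr M (count_space UNIV) (\<lambda>\<omega>. N u \<omega> - N s \<omega>) =
        measure_pmf (poisson_pmf (lam * (u - s)))) \<and>
     (\<forall>(n::nat) \<tau>. 0 \<le> \<tau> 0 \<and> (\<forall>i<n. \<tau> i \<le> \<tau> (Suc i)) \<longrightarrow>
        prob_space.indep_vars M (\<lambda>_. count_space UNIV)
          (\<lambda>i \<omega>. N (\<tau> (Suc i)) \<omega> - N (\<tau> i) \<omega>) {..<n})"

definition switch :: "real \<Rightarrow> real \<Rightarrow> real \<Rightarrow> real" where
  "switch c1 c2 v = (if v = c1 then - c2 else c1)"

definition velocity ::
  "real \<Rightarrow> real \<Rightarrow> (real \<Rightarrow> 'a \<Rightarrow> nat) \<Rightarrow> ('a \<Rightarrow> real) \<Rightarrow> real \<Rightarrow> 'a \<Rightarrow> real" where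
  "velocity c1 c2 N V0 s \<omega> = (switch c1 c2 ^^ N s \<omega>) (V0 \<omega>)"

definition position ::
  "real \<Rightarrow> real \<Rightarrow> (real \<Rightarrow> 'a \<Rightarrow> nat) \<Rightarrow> ('a \<Rightarrow> real) \<Rightarrow> real \<Rightarrow> 'a \<Rightarrow> real" where
  "position c1 c2 N V0 t \<omega> = integral {0..t} (\<lambda>s. velocity c1 c2 N V0 s \<omega>)"

text \<open>
  \<open>V0\<close> is independent of the whole process \<open>N\<close>, regarded as a random element of the product
  space over the time set \<open>{0..}\<close>. The generated sigma-algebras are written out because
  the library's \<open>indep_var\<close> requires both random elements to take values in the same type.
\<close>

definition asymmetric_telegraph ::
  "'a measure \<Rightarrow> real \<Rightarrow> real \<Rightarrow> real \<Rightarrow> (real \<Rightarrow> 'a \<Rightarrow> nat) \<Rightarrow> ('a \<Rightarrow> real) \<Rightarrow> bool" where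
  "asymmetric_telegraph M c1 c2 lam N V0 \<longleftrightarrow>
     prob_space M \<and> c1 > 0 \<and> c2 > 0 \<and> lam > 0 \<and>
     poisson_process M lam N \<and>
     V0 \<in> borel_measurable M \<and> (\<forall>\<omega>\<in>space M. V0 \<omega> \<in> {c1, - c2}) \<and>
     \<P>(\<omega> in M. V0 \<omega> = c1) = 1 / 2 \<and> \<P>(\<omega> in M. V0 \<omega> = - c2) = 1 / 2 \<and>
     prob_space.indep_set M
       (sets (vimage_algebra (space M) V0 borel))
       (sets (vimage_algebra (space M) (\<lambda>\<omega>. \<lambda>s\<in>{0..}. N s \<omega>)
                (Pi\<^sub>M {0..} (\<lambda>_. count_space UNIV))))"

text \<open>
  Modified Bessel function of the first kind, for the orders \<open>r = 0, 1, 2, \<dots>\<close>. The powers are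
  natural-number powers because \<open>0 powr 0 = 0\<close>, which would give the wrong value at
  \<open>x = 0\<close> when \<open>r = 0\<close>.
\<close>

definition bessel_I :: "nat \<Rightarrow> real \<Rightarrow> real" where
  "bessel_I r x =
     (\<Sum>j. (x / 2) ^ (2 * j + r) * (1 / (fact j * Gamma (real j + real r + 1))))"

text \<open>
  \<open>f\<close> with its value at \<open>a\<close> replaced by its limit from the left; used where \<open>f\<close> is written with
  a quotient whose denominator vanishes at \<open>a\<close>.
\<close>

definition left_limit_at :: "real \<Rightarrow> (real \<Rightarrow> real) \<Rightarrow> real \<Rightarrow> real" where
  "left_limit_at a f x = (if x = a then Lim (at_left a) f else f x)"

end

theory Submission
  imports Defs
begin

text \<open>
  Conditionally on \<open>V(0) = - c2\<close> the velocity is \<open>c1\<close> or \<open>- c2\<close> according to the parity of \<open>N\<close>,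
  and the event that the maximum stays below \<open>\<beta>\<close> depends on \<open>N\<close> alone. Suppose that a time \<open>s\<close>
  remains and that the particle may still rise by \<open>\<beta>\<close>. If the remaining path spends time \<open>T\<close>
  falling and time \<open>s - T\<close> rising and ends exactly at the level \<open>\<beta>\<close>, then
  \<open>\<lambda> T = a := \<lambda> (c1 s - \<beta>) / (c1 + c2)\<close> and \<open>\<lambda> (s - T) = b := \<lambda> (c2 s + \<beta>) / (c1 + c2)\<close>.
  In these coordinates a falling particle decreases \<open>a\<close> at rate \<open>\<lambda>\<close> and leaves \<open>b\<close> alone, a rising
  particle does the opposite. So the probabilities \<open>u\<close> (now falling) and \<open>v\<close> (now rising) that the
  level is not exceeded should satisfy

  \<open>\<partial>u/\<partial>a = v - u\<close>, \<open>\<partial>v/\<partial>b = u - v\<close>, \<open>u(0, b) = 1\<close>, \<open>v(a, (c2/c1) a) = 0\<close>: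

  at \<open>a = 0\<close> the level cannot be exceeded any more in the remaining time, and \<open>b = (c2/c1) a\<close> means \<open>\<beta> = 0\<close>,
  where a rising particle crosses at once.

  With independent Poisson variables \<open>A\<close>, \<open>B\<close> of means \<open>a\<close>, \<open>b\<close>, the partial derivatives of
  \<open>E w(A, B)\<close> are \<open>E [w(A + 1, B) - w(A, B)]\<close> and \<open>E [w(A, B + 1) - w(A, B)]\<close>. The system therefore
  turns into shift relations between two weights on \<open>\<nat> \<times> \<nat>\<close>, and the boundary conditions single out
  \<open>up_weight\<close> and \<open>down_weight\<close>. Summing \<open>E w(A, B)\<close> along the diagonals \<open>A - B = const\<close> produces the
  two Bessel series of the theorem (\<open>egf2_down_weight\<close>, \<open>bessel_I_eq_diag_series\<close>).

  That the probability really equals \<open>u\<close> is shown by discretising time, so that only the joint law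
  of finitely many increments enters. Freeze the velocity on each interval of a grid of mesh \<open>h = t/n\<close>. The increments of \<open>N\<close> over the grid are independent Poisson variables,
  so the probability that the frozen walk stays below \<open>\<beta>\<close> obeys an exact one-step recursion
  (\<open>prob_walk_below\<close>). The functions \<open>u\<close>, \<open>v\<close> satisfy this recursion up to \<open>O(h\<^sup>2)\<close> per step, with an
  additional error \<open>O(h)\<close> that is incurred at most once, when a boundary is crossed; hence the
  discrete probabilities converge to \<open>u\<close> (\<open>walk_prob_converges\<close>). On the other hand frozen and true
  path differ by at most \<open>(c1 + c2) h (N(t) + 1)\<close>, because an interval without an event contributes
  no error. This sandwiches the probability for the true path between values that converge to the same
  limit (\<open>prob_sup_down_path_le\<close>).
\<close>

section \<open>Poisson means of weights on pairs of naturals\<close>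

text \<open>
  At most exponential growth, which is preserved by index shifts and makes every series below
  converge absolutely.
\<close>

definition exp_bounded :: "(nat \<Rightarrow> nat \<Rightarrow> real) \<Rightarrow> bool" where
  "exp_bounded w \<longleftrightarrow> (\<exists>K\<ge>0. \<exists>q\<ge>0. \<forall>i j. \<bar>w i j\<bar> \<le> K * q ^ (i + j))"

text \<open>
  The two-variable exponential generating function of \<open>w\<close>.
\<close>

definition egf2 :: "(nat \<Rightarrow> nat \<Rightarrow> real) \<Rightarrow> real \<Rightarrow> real \<Rightarrow> real" where
  "egf2 w a b = (\<Sum>\<^sub>\<infinity>(i, j). w i j * (a ^ i / fact i) * (b ^ j / fact j))"

text \<open>
  This is \<open>E w(A, B)\<close> for independent Poisson variables \<open>A\<close>, \<open>B\<close> of means \<open>a\<close>, \<open>b\<close>. The formula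
  also makes sense for negative arguments, so that derivatives need no one-sided versions at \<open>0\<close>.
\<close>

definition poisson_mean :: "(nat \<Rightarrow> nat \<Rightarrow> real) \<Rightarrow> real \<Rightarrow> real \<Rightarrow> real" where
  "poisson_mean w a b = exp (- (a + b)) * egf2 w a b"

lemma exp_boundedI:
  assumes "\<And>i j. \<bar>w i j\<bar> \<le> K * q ^ (i + j)" "0 \<le> K" "0 \<le> q"
  shows "exp_bounded w"
  unfolding exp_bounded_def using assms by blast

lemma exp_bounded_shift1: "exp_bounded w \<Longrightarrow> exp_bounded (\<lambda>i j. w (Suc i) j)"
proof -
  assume "exp_bounded w"
  then obtain K q where K: "K \<ge> 0" "q \<ge> 0" "\<And>i j. \<bar>w i j\<bar> \<le> K * q ^ (i + j)"
    unfolding exp_bounded_def by blast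
  have "\<bar>w (Suc i) j\<bar> \<le> (K * q) * q ^ (i + j)" for i j
    using K(3)[of "Suc i" j] by (simp add: mult_ac)
  then show ?thesis using K by (intro exp_boundedI[where K = "K * q" and q = q]) auto
qed

lemma exp_bounded_swap: "exp_bounded w \<Longrightarrow> exp_bounded (\<lambda>i j. w j i)"
  unfolding exp_bounded_def by (metis add.commute)

lemma exp_bounded_shift2: "exp_bounded w \<Longrightarrow> exp_bounded (\<lambda>i j. w i (Suc j))"
  by (rule exp_bounded_swap[OF exp_bounded_shift1[OF exp_bounded_swap]])

text \<open>
  The terms factorise, so the double series is the product of two exponential series.
\<close>

lemma exp_terms_abs_summable:
  fixes x y :: real
  shows "(\<lambda>p. norm (case p of (i, j) \<Rightarrow> (x ^ i / fact i) * (y ^ j / fact j))) summable_on UNIV \<times> UNIV"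
proof -
  have s: "(\<lambda>i. norm (x ^ i / fact i)) summable_on UNIV" for x :: real
    using summable_norm_exp[of x]
    by (intro summable_nonneg_imp_summable_on) (simp_all add: divide_inverse mult_ac)
  show ?thesis
    unfolding Infinite_Sum.abs_summable_on_Sigma_iff
  proof (intro conjI ballI)
    fix i
    show "(\<lambda>j. norm (case (i, j) of (i, j) \<Rightarrow> (x ^ i / fact i) * (y ^ j / fact j))) summable_on UNIV"
      using summable_on_cmult_right[OF s[of y], of "norm (x ^ i / fact i)"]
      by (simp only: prod.case norm_mult)
  next
    have "(\<lambda>i. norm (x ^ i / fact i) * (\<Sum>\<^sub>\<infinity>j. norm (y ^ j / fact j))) summable_on UNIV"
      by (intro summable_on_cmult_left s)
    moreover have "norm (x ^ i / fact i) * (\<Sum>\<^sub>\<infinity>j. norm (y ^ j / fact j)) =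
      (\<Sum>\<^sub>\<infinity>j. norm (case (i, j) of (i, j) \<Rightarrow> (x ^ i / fact i) * (y ^ j / fact j)))" for i
      by (simp only: prod.case norm_mult infsum_cmult_right')
    moreover have "(\<Sum>\<^sub>\<infinity>j. norm (case (i, j) of (i, j) \<Rightarrow> (x ^ i / fact i) * (y ^ j / fact j))) \<ge> 0" for i
      by (intro infsum_nonneg) auto
    ultimately show "(\<lambda>i. norm (\<Sum>\<^sub>\<infinity>j. norm (case (i, j) of (i, j) \<Rightarrow> (x ^ i / fact i) * (y ^ j / fact j)))) summable_on UNIV"
      by simp
  qed
qed

lemma egf2_abs_summable:
  assumes "exp_bounded w"
  shows "(\<lambda>p. norm (case p of (i, j) \<Rightarrow> w i j * (a ^ i / fact i) * (b ^ j / fact j))) summable_on UNIV"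
proof -
  obtain K q where K: "K \<ge> 0" "q \<ge> 0" "\<And>i j. \<bar>w i j\<bar> \<le> K * q ^ (i + j)"
    using assms unfolding exp_bounded_def by blast
  have "(\<lambda>p. K * norm (case p of (i, j) \<Rightarrow> ((q * \<bar>a\<bar>) ^ i / fact i) * ((q * \<bar>b\<bar>) ^ j / fact j))) summable_on UNIV"
    using exp_terms_abs_summable[of "q * \<bar>a\<bar>" "q * \<bar>b\<bar>"] by (intro summable_on_cmult_right) simp
  moreover have "norm (case p of (i, j) \<Rightarrow> w i j * (a ^ i / fact i) * (b ^ j / fact j)) \<le>
     K * norm (case p of (i, j) \<Rightarrow> ((q * \<bar>a\<bar>) ^ i / fact i) * ((q * \<bar>b\<bar>) ^ j / fact j))" for p
  proof -
    obtain i j where p: "p = (i, j)" by fastforce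
    have "\<bar>w i j\<bar> * (\<bar>a\<bar> ^ i / fact i) * (\<bar>b\<bar> ^ j / fact j) \<le> (K * q ^ (i + j)) * (\<bar>a\<bar> ^ i / fact i) * (\<bar>b\<bar> ^ j / fact j)"
      by (intro mult_right_mono K) auto
    then show ?thesis using K(2) unfolding p
      by (simp add: abs_mult power_abs power_mult_distrib power_add mult_ac)
  qed
  ultimately show ?thesis
    by (rule Infinite_Sum.abs_summable_on_comparison_test')
qed

lemma infsum_nat_eq_suminf:
  fixes f :: "nat \<Rightarrow> real"
  assumes "f summable_on UNIV"
  shows "infsum f UNIV = suminf f"
  using has_sum_imp_sums[OF has_sum_infsum[OF assms]] by (simp add: sums_iff)

lemma egf2_swap: "egf2 w a b = egf2 (\<lambda>i j. w j i) b a"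
proof -
  have "bij_betw prod.swap UNIV (UNIV :: (nat \<times> nat) set)" by simp
  from infsum_reindex_bij_betw[OF this, of "\<lambda>(i, j). w i j * (a ^ i / fact i) * (b ^ j / fact j)"]
  show ?thesis unfolding egf2_def
    by (simp add: prod.swap_def case_prod_unfold mult_ac)
qed

text \<open>
  For fixed \<open>b\<close> the inner sums are the coefficients of an everywhere convergent power series in \<open>a\<close>,
  and differentiating an exponential generating function shifts its coefficients.
\<close>

lemma egf2_DERIV1:
  assumes w: "exp_bounded w"
  shows "((\<lambda>a. egf2 w a b) has_real_derivative egf2 (\<lambda>i j. w (Suc i) j) a b) (at a)"
proof -
  define g where "g w i = (\<Sum>\<^sub>\<infinity>j. w i j * (b ^ j / fact j))" for w :: "nat \<Rightarrow> nat \<Rightarrow> real" and i :: nat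
  have rep: "(\<lambda>i. g w i / fact i * a ^ i) summable_on UNIV"
            "egf2 w a b = (\<Sum>i. g w i / fact i * a ^ i)" if w: "exp_bounded w" for w a
  proof -
    note s = abs_summable_summable[OF egf2_abs_summable[OF w, of a b], folded UNIV_Times_UNIV]
    have eq: "(\<Sum>\<^sub>\<infinity>j. w i j * (a ^ i / fact i) * (b ^ j / fact j)) = g w i / fact i * a ^ i" for i
    proof -
      have "(\<Sum>\<^sub>\<infinity>j. w i j * (a ^ i / fact i) * (b ^ j / fact j)) =
        (\<Sum>\<^sub>\<infinity>j. (a ^ i / fact i) * (w i j * (b ^ j / fact j)))"
        by (simp only: mult_ac)
      then show ?thesis unfolding g_def infsum_cmult_right' by simp
    qed
    show 1: "(\<lambda>i. g w i / fact i * a ^ i) summable_on UNIV"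
      using summable_on_Sigma_banach[OF s] unfolding eq .
    show "egf2 w a b = (\<Sum>i. g w i / fact i * a ^ i)"
      using infsum_Sigma'_banach[OF s] unfolding eq infsum_nat_eq_suminf[OF 1]
      by (simp add: egf2_def)
  qed
  have "((\<lambda>a. \<Sum>i. g w i / fact i * a ^ i) has_real_derivative
      (\<Sum>i. diffs (\<lambda>i. g w i / fact i) i * a ^ i)) (at a)"
    by (intro termdiffs_strong_converges_everywhere summable_on_imp_summable rep w)
  moreover have "diffs (\<lambda>i. g w i / fact i) = (\<lambda>i. g (\<lambda>i j. w (Suc i) j) i / fact i)"
    by (intro ext) (simp add: diffs_def g_def fact_Suc del: of_nat_Suc)
  ultimately show ?thesis
    by (simp add: rep[OF w] rep[OF exp_bounded_shift1[OF w]])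
qed

lemma poisson_mean_swap: "poisson_mean w a b = poisson_mean (\<lambda>i j. w j i) b a"
  unfolding poisson_mean_def by (subst egf2_swap) (simp add: add.commute)

lemma poisson_mean_DERIV1:
  assumes w: "exp_bounded w"
  shows "((\<lambda>a. poisson_mean w a b) has_real_derivative
           poisson_mean (\<lambda>i j. w (Suc i) j) a b - poisson_mean w a b) (at a)"
  unfolding poisson_mean_def
  by (auto intro!: derivative_eq_intros egf2_DERIV1[OF w] simp: algebra_simps)

lemma poisson_mean_DERIV2:
  assumes w: "exp_bounded w"
  shows "((\<lambda>b. poisson_mean w a b) has_real_derivative
           poisson_mean (\<lambda>i j. w i (Suc j)) a b - poisson_mean w a b) (at b)"
  using poisson_mean_DERIV1[OF exp_bounded_swap[OF w], of a b]
  by (simp only: poisson_mean_swap[of w a] poisson_mean_swap[of "\<lambda>i j. w i (Suc j)" a])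

lemma poisson_mean_bounded:
  assumes w: "exp_bounded w"
  shows "\<exists>B\<ge>0. \<forall>a\<in>{0..R}. \<forall>b\<in>{0..R}. \<bar>poisson_mean w a b\<bar> \<le> B"
proof -
  let ?s = "\<lambda>a b. (\<Sum>\<^sub>\<infinity>(i, j). \<bar>w i j\<bar> * (a ^ i / fact i) * (b ^ j / fact j))"
  have "\<bar>poisson_mean w a b\<bar> \<le> ?s R R" if "a \<in> {0..R}" "b \<in> {0..R}" for a b
  proof -
    have aw: "exp_bounded (\<lambda>i j. \<bar>w i j\<bar>)" using w by (simp add: exp_bounded_def)
    have sm: "(\<lambda>(i, j). \<bar>w i j\<bar> * (a ^ i / fact i) * (b ^ j / fact j)) summable_on UNIV" for a b
      by (rule abs_summable_summable[OF egf2_abs_summable[OF aw]])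
    have "\<bar>poisson_mean w a b\<bar> \<le> \<bar>egf2 w a b\<bar>"
      using that by (simp add: poisson_mean_def abs_mult mult_left_le_one_le)
    also have "\<dots> \<le> (\<Sum>\<^sub>\<infinity>p. norm (case p of (i, j) \<Rightarrow> w i j * (a ^ i / fact i) * (b ^ j / fact j)))"
      using norm_infsum_bound[OF egf2_abs_summable[OF w, of a b]] by (simp add: egf2_def)
    also have "\<dots> = ?s a b"
      using that by (intro infsum_cong) (auto simp: abs_mult)
    also have "\<dots> \<le> ?s R R"
    proof (intro infsum_mono sm)
      fix p :: "nat \<times> nat"
      show "(case p of (i, j) \<Rightarrow> \<bar>w i j\<bar> * (a ^ i / fact i) * (b ^ j / fact j))
        \<le> (case p of (i, j) \<Rightarrow> \<bar>w i j\<bar> * (R ^ i / fact i) * (R ^ j / fact j))"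
        using that by (auto split: prod.split intro!: mult_mono divide_right_mono power_mono)
    qed
    finally show ?thesis .
  qed
  then show ?thesis
    by (intro exI[of _ "max 0 (?s R R)"]) (auto simp: le_max_iff_disj)
qed

text \<open>
  Both partial derivatives are differences of Poisson means, hence bounded on the square. The bound on
  the approximation error and all continuity statements rest on this estimate.
\<close>

lemma poisson_mean_Lipschitz:
  assumes w: "exp_bounded w"
  shows "\<exists>L\<ge>0. \<forall>a\<in>{0..R}. \<forall>b\<in>{0..R}. \<forall>a'\<in>{0..R}. \<forall>b'\<in>{0..R}.
           \<bar>poisson_mean w a b - poisson_mean w a' b'\<bar> \<le> L * (\<bar>a - a'\<bar> + \<bar>b - b'\<bar>)"
proof -
  obtain B0 where B0: "B0 \<ge> 0" "\<And>a b. a\<in>{0..R} \<Longrightarrow> b\<in>{0..R} \<Longrightarrow> \<bar>poisson_mean w a b\<bar> \<le> B0"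
    using poisson_mean_bounded[OF w, of R] by blast
  obtain B1 where B1: "B1 \<ge> 0" "\<And>a b. a\<in>{0..R} \<Longrightarrow> b\<in>{0..R} \<Longrightarrow> \<bar>poisson_mean (\<lambda>i j. w (Suc i) j) a b\<bar> \<le> B1"
    using poisson_mean_bounded[OF exp_bounded_shift1[OF w], of R] by blast
  obtain B2 where B2: "B2 \<ge> 0" "\<And>a b. a\<in>{0..R} \<Longrightarrow> b\<in>{0..R} \<Longrightarrow> \<bar>poisson_mean (\<lambda>i j. w i (Suc j)) a b\<bar> \<le> B2"
    using poisson_mean_bounded[OF exp_bounded_shift2[OF w], of R] by blast
  let ?L = "B0 + B1 + B2"
  have "\<bar>poisson_mean w a b - poisson_mean w a' b'\<bar> \<le> ?L * (\<bar>a - a'\<bar> + \<bar>b - b'\<bar>)"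
    if "a\<in>{0..R}" "b\<in>{0..R}" "a'\<in>{0..R}" "b'\<in>{0..R}" for a b a' b'
  proof -
    have 1: "norm (poisson_mean w a b - poisson_mean w a' b) \<le> ?L * norm (a - a')"
    proof (rule field_differentiable_bound[OF convex_real_interval(5)[of 0 R]])
      show "((\<lambda>a. poisson_mean w a b) has_field_derivative
           poisson_mean (\<lambda>i j. w (Suc i) j) z b - poisson_mean w z b) (at z within {0..R})" for z
        using poisson_mean_DERIV1[OF w] by (rule has_field_derivative_at_within)
      show "norm (poisson_mean (\<lambda>i j. w (Suc i) j) z b - poisson_mean w z b) \<le> ?L" if "z \<in> {0..R}" for z
        using B0(2)[OF that \<open>b \<in> _\<close>] B1(2)[OF that \<open>b \<in> _\<close>] B2(1) by simp
    qed (use that in auto)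
    have 2: "norm (poisson_mean w a' b - poisson_mean w a' b') \<le> ?L * norm (b - b')"
    proof (rule field_differentiable_bound[OF convex_real_interval(5)[of 0 R]])
      show "((\<lambda>b. poisson_mean w a' b) has_field_derivative
           poisson_mean (\<lambda>i j. w i (Suc j)) a' z - poisson_mean w a' z) (at z within {0..R})" for z
        using poisson_mean_DERIV2[OF w] by (rule has_field_derivative_at_within)
      show "norm (poisson_mean (\<lambda>i j. w i (Suc j)) a' z - poisson_mean w a' z) \<le> ?L" if "z \<in> {0..R}" for z
        using B0(2)[OF \<open>a' \<in> _\<close> that] B2(2)[OF \<open>a' \<in> _\<close> that] B1(1) by simp
    qed (use that in auto)
    have "\<bar>poisson_mean w a b - poisson_mean w a' b'\<bar> \<le>
      \<bar>poisson_mean w a b - poisson_mean w a' b\<bar> + \<bar>poisson_mean w a' b - poisson_mean w a' b'\<bar>"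
      by linarith
    also have "\<dots> \<le> ?L * \<bar>a - a'\<bar> + ?L * \<bar>b - b'\<bar>" using 1 2 by simp
    finally show ?thesis by (simp add: distrib_left)
  qed
  then show ?thesis using B0(1) B1(1) B2(1) by (intro exI[of _ ?L]) auto
qed

lemma poisson_mean_tendsto:
  assumes w: "exp_bounded w" and f: "(f \<longlongrightarrow> a) F" and g: "(g \<longlongrightarrow> b) F"
    and f0: "\<forall>\<^sub>F x in F. 0 \<le> f x" and g0: "\<forall>\<^sub>F x in F. 0 \<le> g x" and ab: "0 \<le> a" "0 \<le> b"
  shows "((\<lambda>x. poisson_mean w (f x) (g x)) \<longlongrightarrow> poisson_mean w a b) F"
proof -
  define R where "R = max a b + 1"
  obtain L where L: "\<And>a b a' b'. a\<in>{0..R} \<Longrightarrow> b\<in>{0..R} \<Longrightarrow> a'\<in>{0..R} \<Longrightarrow> b'\<in>{0..R} \<Longrightarrow>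
      \<bar>poisson_mean w a b - poisson_mean w a' b'\<bar> \<le> L * (\<bar>a - a'\<bar> + \<bar>b - b'\<bar>)"
    using poisson_mean_Lipschitz[OF w, of R] by blast
  have "\<forall>\<^sub>F x in F. f x < R" "\<forall>\<^sub>F x in F. g x < R"
    using order_tendstoD(2)[OF f, of R] order_tendstoD(2)[OF g, of R] by (auto simp: R_def)
  with f0 g0 have ev: "\<forall>\<^sub>F x in F. norm (poisson_mean w (f x) (g x) - poisson_mean w a b)
      \<le> L * (\<bar>f x - a\<bar> + \<bar>g x - b\<bar>)"
    by eventually_elim (use ab in \<open>auto intro!: L simp: R_def\<close>)
  have "((\<lambda>x. L * (\<bar>f x - a\<bar> + \<bar>g x - b\<bar>)) \<longlongrightarrow> L * (\<bar>a - a\<bar> + \<bar>b - b\<bar>)) F"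
    by (intro tendsto_intros f g)
  then have "((\<lambda>x. poisson_mean w (f x) (g x) - poisson_mean w a b) \<longlongrightarrow> 0) F"
    by (intro Lim_null_comparison[OF ev]) simp
  then show ?thesis by (rule LIM_zero_cancel)
qed

section \<open>The candidate probabilities\<close>

text \<open>
  Where the weights come from: the differential system translates into
  \<open>down (i + 1, j) = up (i, j)\<close> and \<open>up (i, j + 1) = down (i, j)\<close>, so both depend on \<open>i - j\<close> only. The
  value \<open>1\<close> at \<open>a = 0\<close> gives \<open>up = 1\<close> for \<open>i < j\<close>. Vanishing on the line \<open>b = \<rho> a\<close> follows if
  \<open>\<rho>\<^sup>j up (i, j)\<close> is antisymmetric, which determines the remaining values. The parameter \<open>\<rho>\<close> stands
  for \<open>c2 / c1\<close>.
\<close>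

definition up_weight :: "real \<Rightarrow> nat \<Rightarrow> nat \<Rightarrow> real" where
  "up_weight \<rho> i j = (if i < j then 1 else if i = j then 0 else - (\<rho> ^ (i - j)))"

definition down_weight :: "real \<Rightarrow> nat \<Rightarrow> nat \<Rightarrow> real" where
  "down_weight \<rho> i j = up_weight \<rho> i (Suc j)"

lemma down_weight_Suc: "down_weight \<rho> (Suc i) j = up_weight \<rho> i j"
  by (auto simp: down_weight_def up_weight_def)

lemma exp_bounded_up_weight:
  assumes "\<rho> \<ge> 0"
  shows "exp_bounded (up_weight \<rho>)"
proof -
  have "\<bar>up_weight \<rho> i j\<bar> \<le> 1 * max 1 \<rho> ^ (i + j)" for i j
  proof -
    have "\<rho> ^ (i - j) \<le> max 1 \<rho> ^ (i - j)" using assms by (intro power_mono) auto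
    also have "\<dots> \<le> max 1 \<rho> ^ (i + j)" by (intro power_increasing) auto
    finally show ?thesis using assms by (auto simp: up_weight_def)
  qed
  then show ?thesis by (rule exp_boundedI) auto
qed

lemma exp_bounded_down_weight: "\<rho> \<ge> 0 \<Longrightarrow> exp_bounded (down_weight \<rho>)"
  using exp_bounded_shift2[OF exp_bounded_up_weight] by (simp add: down_weight_def[abs_def])

text \<open>
  The names anticipate the use: these are the limits of the probabilities that a particle which is now
  falling, respectively rising, does not exceed its level.
\<close>

definition down_prob :: "real \<Rightarrow> real \<Rightarrow> real \<Rightarrow> real" where
  "down_prob \<rho> = poisson_mean (down_weight \<rho>)"

definition up_prob :: "real \<Rightarrow> real \<Rightarrow> real \<Rightarrow> real" where
  "up_prob \<rho> = poisson_mean (up_weight \<rho>)"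

lemma down_prob_DERIV:
  assumes "\<rho> \<ge> 0"
  shows "((\<lambda>a. down_prob \<rho> a b) has_real_derivative up_prob \<rho> a b - down_prob \<rho> a b) (at a)"
  using poisson_mean_DERIV1[OF exp_bounded_down_weight[OF assms]]
  unfolding down_prob_def up_prob_def down_weight_Suc by simp

lemma up_prob_DERIV:
  assumes "\<rho> \<ge> 0"
  shows "((\<lambda>b. up_prob \<rho> a b) has_real_derivative down_prob \<rho> a b - up_prob \<rho> a b) (at b)"
  using poisson_mean_DERIV2[OF exp_bounded_up_weight[OF assms]]
  unfolding down_prob_def up_prob_def down_weight_def[abs_def] by simp

section \<open>Bessel functions as sums along diagonals\<close>

text \<open>
  Up to the factor \<open>exp (- (a + b))\<close> this is the probability of \<open>B - A = r\<close>.
\<close>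

definition diag_series :: "nat \<Rightarrow> real \<Rightarrow> real \<Rightarrow> real" where
  "diag_series r a b = (\<Sum>j. (a ^ j / fact j) * (b ^ (j + r) / fact (j + r)))"

text \<open>
  Reindexing of an absolutely convergent double series by \<open>(i, j) \<mapsto> (j - i, i)\<close>.
\<close>

lemma egf2_sums_diag_series:
  assumes \<phi>: "\<And>r. \<bar>\<phi> r\<bar> \<le> K * q ^ r" and K: "K \<ge> 0" "q \<ge> 0"
  shows "(\<lambda>r. \<phi> r * diag_series r a b) sums egf2 (\<lambda>i j. if i \<le> j then \<phi> (j - i) else 0) a b"
    and "exp_bounded (\<lambda>i j. if i \<le> j then \<phi> (j - i) else 0)"
proof -
  let ?w = "\<lambda>i j. if i \<le> j then \<phi> (j - i) else 0"
  let ?F = "\<lambda>(i, j). ?w i j * (a ^ i / fact i) * (b ^ j / fact j)"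
  let ?h = "\<lambda>(r, j). (j, j + r) :: nat \<times> nat"
  let ?T = "\<lambda>r j. (a ^ j / fact j) * (b ^ (j + r) / fact (j + r))"
  have bd: "exp_bounded (\<lambda>i j. if i \<le> j then \<psi> (j - i) else 0)"
    if \<psi>: "\<And>r. \<bar>\<psi> r\<bar> \<le> K * q ^ r" and K: "K \<ge> 0" "q \<ge> 0" for \<psi> :: "nat \<Rightarrow> real" and K q
  proof -
    have "\<bar>if i \<le> j then \<psi> (j - i) else 0\<bar> \<le> K * max 1 q ^ (i + j)" for i j
    proof -
      have "q ^ (j - i) \<le> max 1 q ^ (j - i)" using K by (intro power_mono) auto
      also have "\<dots> \<le> max 1 q ^ (i + j)" by (intro power_increasing) auto
      finally have "K * q ^ (j - i) \<le> K * max 1 q ^ (i + j)" using K by (intro mult_left_mono)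
      then show ?thesis using \<psi>[of "j - i"] K by auto
    qed
    then show ?thesis by (rule exp_boundedI) (use K in auto)
  qed
  show w: "exp_bounded ?w" by (rule bd[OF \<phi> K])
  have bij: "bij_betw ?h UNIV {(i, j). i \<le> j}"
    by (rule bij_betwI[of _ _ _ "\<lambda>(i, j). (j - i, i)"]) auto
  have comp: "?F (?h p) = (case p of (r, j) \<Rightarrow> \<phi> r * ?T r j)" for p
    by (auto split: prod.split)
  have F: "?F summable_on UNIV" by (rule abs_summable_summable[OF egf2_abs_summable[OF w]])
  have sm: "(\<lambda>(r, j). \<phi> r * ?T r j) summable_on UNIV \<times> UNIV"
    using summable_on_subset_banach[OF F, of "{(i, j). i \<le> j}"]
    unfolding summable_on_reindex_bij_betw[OF bij, of ?F, symmetric] comp by simp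
  have "egf2 ?w a b = infsum ?F {(i, j). i \<le> j}"
    unfolding egf2_def by (rule infsum_cong_neutral) auto
  also have "\<dots> = (\<Sum>\<^sub>\<infinity>(r, j)\<in>UNIV \<times> UNIV. \<phi> r * ?T r j)"
    unfolding infsum_reindex_bij_betw[OF bij, of ?F, symmetric] comp by simp
  also have "\<dots> = (\<Sum>\<^sub>\<infinity>r. \<Sum>\<^sub>\<infinity>j. \<phi> r * ?T r j)"
    by (rule infsum_Sigma'_banach[OF sm, symmetric])
  finally have eq: "egf2 ?w a b = (\<Sum>\<^sub>\<infinity>r. \<Sum>\<^sub>\<infinity>j. \<phi> r * ?T r j)" .
  have inner: "(\<Sum>\<^sub>\<infinity>j. ?T r j) = diag_series r a b" for r
  proof -
    have w1: "exp_bounded (\<lambda>i j. if i \<le> j then 1 else 0)"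
      using bd[of "\<lambda>_. 1" 1 1] by simp
    have "(\<lambda>(i, j). (if i \<le> j then 1 else 0) * (a ^ i / fact i) * (b ^ j / fact j)) summable_on range (\<lambda>j. (j, j + r))"
      by (rule summable_on_subset_banach[OF abs_summable_summable[OF egf2_abs_summable[OF w1]]]) simp
    then have "(\<lambda>j. ?T r j) summable_on UNIV"
      by (subst (asm) summable_on_reindex) (auto simp: inj_on_def o_def)
    then show ?thesis unfolding diag_series_def by (rule infsum_nat_eq_suminf)
  qed
  have "(\<lambda>r. \<phi> r * diag_series r a b) summable_on UNIV"
    using summable_on_Sigma_banach[OF sm] by (simp only: infsum_cmult_right' inner)
  moreover have "egf2 ?w a b = (\<Sum>\<^sub>\<infinity>r. \<phi> r * diag_series r a b)"
    using eq by (simp only: infsum_cmult_right' inner)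
  ultimately show "(\<lambda>r. \<phi> r * diag_series r a b) sums egf2 ?w a b"
    using has_sum_imp_sums[OF has_sum_infsum] by metis
qed

lemma diag_series_summable: "summable (\<lambda>j. (a ^ j / fact j) * (b ^ (j + r) / fact (j + r)) :: real)"
proof -
  have "exp_bounded (\<lambda>i j. 1)" by (rule exp_boundedI[where K = 1 and q = 1]) auto
  from summable_on_subset_banach[OF abs_summable_summable[OF egf2_abs_summable[OF this]]]
  have "(\<lambda>(i, j). (a ^ i / fact i) * (b ^ j / fact j)) summable_on range (\<lambda>j. (j, j + r))"
    by simp
  then show ?thesis
    by (subst (asm) summable_on_reindex) (auto simp: inj_on_def o_def intro: summable_on_imp_summable)
qed

text \<open>
  The part \<open>i \<le> j\<close>, where the weight is \<open>1\<close>, gives the first series; the part \<open>i \<ge> j + 2\<close> gives the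
  second one after exchanging the roles of \<open>a\<close> and \<open>b\<close>. The diagonal \<open>i = j + 1\<close> has weight \<open>0\<close>, which is
  why the second sum of the theorem starts at \<open>r = 2\<close>.
\<close>

lemma egf2_down_weight:
  assumes \<rho>: "\<rho> \<ge> 0"
  shows "egf2 (down_weight \<rho>) a b =
    (\<Sum>r. diag_series r a b) - (\<Sum>k. \<rho> ^ (k + 1) * diag_series (k + 2) b a)"
proof -
  let ?w1 = "\<lambda>i j. if i \<le> j then 1 else 0 :: real"
  define \<phi> where "\<phi> r = (if r \<ge> 2 then \<rho> ^ (r - 1) else 0)" for r :: nat
  let ?w2 = "\<lambda>i j. if i \<le> j then \<phi> (j - i) else 0"
  have b: "\<bar>\<phi> r\<bar> \<le> 1 * max 1 \<rho> ^ r" for r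
  proof -
    have "\<rho> ^ (r - 1) \<le> max 1 \<rho> ^ (r - 1)" using \<rho> by (intro power_mono) auto
    also have "\<dots> \<le> max 1 \<rho> ^ r" by (intro power_increasing) auto
    finally show ?thesis using \<rho> by (auto simp: \<phi>_def)
  qed
  note 1 = egf2_sums_diag_series[of "\<lambda>_. 1" 1 1, simplified]
  have "0 \<le> max 1 \<rho>" by simp
  note 2 = egf2_sums_diag_series[of \<phi>, OF b zero_le_one this]
  have "down_weight \<rho> i j = ?w1 i j - ?w2 j i" for i j
    by (auto simp: down_weight_def up_weight_def \<phi>_def)
  then have "down_weight \<rho> = (\<lambda>i j. ?w1 i j - ?w2 j i)" by (intro ext)
  then have "egf2 (down_weight \<rho>) a b = (\<Sum>\<^sub>\<infinity>p. (case p of (i, j) \<Rightarrow> ?w1 i j * (a ^ i / fact i) * (b ^ j / fact j))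
      - (case p of (i, j) \<Rightarrow> ?w2 j i * (a ^ i / fact i) * (b ^ j / fact j)))"
    unfolding egf2_def by (simp only: case_prod_unfold left_diff_distrib)
  also have "\<dots> = egf2 ?w1 a b - egf2 (\<lambda>i j. ?w2 j i) a b"
    unfolding egf2_def diff_conv_add_uminus infsum_uminus[symmetric]
    by (intro infsum_add summable_on_uminus[THEN iffD2] abs_summable_summable[OF egf2_abs_summable]
          1(2) exp_bounded_swap[OF 2(2)])
  also have "egf2 ?w1 a b = (\<Sum>r. diag_series r a b)"
    using 1(1) by (simp add: sums_iff)
  also have "egf2 (\<lambda>i j. ?w2 j i) a b = egf2 ?w2 b a"
    by (rule egf2_swap)
  also have "\<dots> = (\<Sum>r. \<phi> r * diag_series r b a)"
    using 2(1) by (simp add: sums_iff)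
  also have "\<dots> = (\<Sum>k. \<phi> (k + 2) * diag_series (k + 2) b a)"
    using suminf_split_initial_segment[OF sums_summable[OF 2(1)], of b a 2]
    by (simp add: numeral_2_eq_2 \<phi>_def)
  finally show ?thesis by (simp add: \<phi>_def)
qed

text \<open>
  This presents a single diagonal as a Poisson mean, so that it inherits continuity.
\<close>

lemma diag_series_eq_poisson_mean:
  shows "diag_series r a b = exp (a + b) * poisson_mean (\<lambda>i j. if i \<le> j then of_bool (j - i = r) else 0) a b"
    and "exp_bounded (\<lambda>i j. if i \<le> j then of_bool (j - i = r) else 0)"
proof -
  note 1 = egf2_sums_diag_series[of "\<lambda>s. of_bool (s = r)" 1 1, simplified]
  show "exp_bounded (\<lambda>i j. if i \<le> j then of_bool (j - i = r) else 0)" by (rule 1(2))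
  have "(\<Sum>s. of_bool (s = r) * diag_series s a b) = diag_series r a b"
    by (subst suminf_finite[of "{r}"]) auto
  then have "egf2 (\<lambda>i j. if i \<le> j then of_bool (j - i = r) else 0) a b = diag_series r a b"
    using 1(1)[of a b] by (simp add: sums_iff)
  then show "diag_series r a b = exp (a + b) * poisson_mean (\<lambda>i j. if i \<le> j then of_bool (j - i = r) else 0) a b"
    by (simp add: poisson_mean_def mult.assoc[symmetric] exp_add[symmetric])
qed

lemma diag_series_tendsto:
  assumes "(f \<longlongrightarrow> a) F" "(g \<longlongrightarrow> b) F"
    and "\<forall>\<^sub>F x in F. 0 \<le> f x" "\<forall>\<^sub>F x in F. 0 \<le> g x" "0 \<le> a" "0 \<le> b"
  shows "((\<lambda>x. diag_series r (f x) (g x)) \<longlongrightarrow> diag_series r a b) F"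
  unfolding diag_series_eq_poisson_mean(1)
  by (intro tendsto_intros poisson_mean_tendsto diag_series_eq_poisson_mean(2) assms)

text \<open>
  The square roots cancel, because \<open>sqrt (a * b) * sqrt (b / a) = b\<close>, so the \<open>j\<close>-th term is
  \<open>a ^ j * b ^ (j + r)\<close> divided by \<open>j! (j + r)!\<close>. The right-hand side no longer has a singularity at \<open>a = 0\<close>.
\<close>

lemma bessel_I_eq_diag_series:
  assumes "a > 0" "b > 0"
  shows "bessel_I r (2 * sqrt (a * b)) * sqrt (b / a) ^ r = diag_series r a b"
proof -
  have t: "sqrt (a * b) ^ (2 * j + r) * (1 / (fact j * Gamma (real j + real r + 1))) * sqrt (b / a) ^ r =
     (a ^ j / fact j) * (b ^ (j + r) / fact (j + r))" for j
  proof -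
    have G: "Gamma (real j + real r + 1) = fact (j + r)"
      using Gamma_fact[of "j + r", where 'a = real] by (simp add: add_ac)
    have "sqrt (a * b) ^ (2 * j + r) * sqrt (b / a) ^ r = sqrt (a * b) ^ (2 * j) * (sqrt (a * b) * sqrt (b / a)) ^ r"
      by (simp add: power_add power_mult_distrib)
    also have "sqrt (a * b) * sqrt (b / a) = b"
      using assms by (simp add: real_sqrt_mult real_sqrt_divide)
    also have "sqrt (a * b) ^ (2 * j) = a ^ j * b ^ j"
      using assms by (simp add: power_mult power_mult_distrib)
    finally have "sqrt (a * b) ^ (2 * j + r) * sqrt (b / a) ^ r = a ^ j * b ^ (j + r)"
      by (simp add: power_add)
    then show ?thesis unfolding G by (simp add: field_simps)
  qed
  have c: "sqrt (b / a) ^ r \<noteq> 0" using assms by simp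
  have "(\<lambda>j. sqrt (a * b) ^ (2 * j + r) * (1 / (fact j * Gamma (real j + real r + 1)))) =
    (\<lambda>j. (a ^ j / fact j) * (b ^ (j + r) / fact (j + r)) / sqrt (b / a) ^ r)"
    using t c by (simp add: fun_eq_iff field_simps)
  then have "bessel_I r (2 * sqrt (a * b)) =
    (\<Sum>j. (a ^ j / fact j) * (b ^ (j + r) / fact (j + r)) / sqrt (b / a) ^ r)"
    by (simp add: bessel_I_def)
  also have "\<dots> = diag_series r a b / sqrt (b / a) ^ r"
    unfolding diag_series_def by (rule suminf_divide[OF diag_series_summable])
  finally show ?thesis using c by simp
qed

section \<open>Boundary values\<close>

text \<open>
  For \<open>a = 0\<close> only \<open>i = 0\<close> contributes, where the weight is constantly \<open>1\<close>.
\<close>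

lemma down_prob_front: "down_prob \<rho> 0 b = 1"
proof -
  have "egf2 (down_weight \<rho>) 0 b = (\<Sum>\<^sub>\<infinity>(i, j)\<in>range (Pair 0). down_weight \<rho> i j * (0 ^ i / fact i) * (b ^ j / fact j))"
    unfolding egf2_def by (rule infsum_cong_neutral) (auto simp: image_iff)
  also have "\<dots> = (\<Sum>\<^sub>\<infinity>j. b ^ j / fact j)"
    by (subst infsum_reindex) (auto simp: inj_on_def o_def down_weight_def up_weight_def)
  also have "\<dots> = exp b"
  proof -
    have "(\<lambda>j. b ^ j / fact j) summable_on UNIV"
      using summable_norm_exp[of b]
      by (intro norm_summable_imp_summable_on) (simp_all add: divide_inverse mult_ac)
    from infsum_nat_eq_suminf[OF this] show ?thesis
      by (simp add: exp_def divide_inverse mult_ac)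
  qed
  finally show ?thesis by (simp add: down_prob_def poisson_mean_def exp_minus)
qed

text \<open>
  On this line the series equals its own negative, by exchanging \<open>i\<close> and \<open>j\<close>.
\<close>

lemma up_prob_barrier: "up_prob \<rho> a (\<rho> * a) = 0"
proof -
  let ?w = "\<lambda>i j. up_weight \<rho> i j * \<rho> ^ j"
  have "egf2 (up_weight \<rho>) a (\<rho> * a) = egf2 ?w a a"
    unfolding egf2_def by (intro infsum_cong) (auto simp: power_mult_distrib)
  moreover have "egf2 ?w a a = egf2 (\<lambda>i j. ?w j i) a a"
    by (rule egf2_swap)
  moreover have antisym: "(\<lambda>i j. ?w j i) = (\<lambda>i j. - ?w i j)"
  proof (intro ext)
    fix i j :: nat
    show "?w j i = - ?w i j"
      by (cases i j rule: linorder_cases) (auto simp: up_weight_def power_add[symmetric])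
  qed
  moreover have "egf2 (\<lambda>i j. ?w j i) a a = - egf2 ?w a a"
    unfolding antisym unfolding egf2_def infsum_uminus[symmetric] by (intro infsum_cong) auto
  ultimately have "egf2 (up_weight \<rho>) a (\<rho> * a) = 0" by linarith
  then show ?thesis by (simp add: up_prob_def poisson_mean_def)
qed

section \<open>Convergence of the one-step recursion\<close>

text \<open>
  For \<open>f' = g - f\<close> the mean value theorem gives \<open>f x = (1 - \<delta>) f (x - \<delta>) + \<delta> g (x - \<delta>)\<close> up to a term of
  order \<open>\<delta>\<^sup>2\<close>; replacing \<open>\<delta>\<close> by the true switching probability \<open>p\<close> costs another term of that order.
\<close>

lemma one_step_consistency:
  fixes f g :: "real \<Rightarrow> real"
  assumes f: "\<And>z. (f has_real_derivative g z - f z) (at z)" and \<delta>: "\<delta> > 0"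
    and p: "\<bar>p - \<delta>\<bar> \<le> \<delta>\<^sup>2"
    and lip: "\<And>z. z \<in> {x - \<delta>..x} \<Longrightarrow> \<bar>(g z - f z) - (g (x - \<delta>) - f (x - \<delta>))\<bar> \<le> K * \<bar>z - (x - \<delta>)\<bar>"
    and B: "\<bar>g (x - \<delta>) - f (x - \<delta>)\<bar> \<le> B" and K: "K \<ge> 0"
  shows "\<bar>(1 - p) * f (x - \<delta>) + p * g (x - \<delta>) - f x\<bar> \<le> (B + K) * \<delta>\<^sup>2"
proof -
  obtain z where z: "x - \<delta> < z" "z < x" "f x - f (x - \<delta>) = \<delta> * (g z - f z)"
    using MVT2[of "x - \<delta>" x f "\<lambda>z. g z - f z"] f \<delta> by auto
  let ?d = "g (x - \<delta>) - f (x - \<delta>)"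
  have "(1 - p) * f (x - \<delta>) + p * g (x - \<delta>) - f x = (p - \<delta>) * ?d - \<delta> * ((g z - f z) - ?d)"
    using z(3) by (simp add: algebra_simps)
  also have "\<bar>\<dots>\<bar> \<le> \<bar>p - \<delta>\<bar> * \<bar>?d\<bar> + \<delta> * \<bar>(g z - f z) - ?d\<bar>"
    using \<delta> by (metis abs_mult abs_of_pos abs_triangle_ineq4)
  also have "\<dots> \<le> \<delta>\<^sup>2 * B + \<delta> * (K * \<delta>)"
  proof (intro add_mono mult_mono p B)
    have "\<bar>(g z - f z) - ?d\<bar> \<le> K * \<bar>z - (x - \<delta>)\<bar>" using z by (intro lip) auto
    also have "\<dots> \<le> K * \<delta>" using z K by (intro mult_left_mono) auto
    finally show "\<bar>(g z - f z) - ?d\<bar> \<le> K * \<delta>" .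
  qed (use \<delta> in auto)
  finally show ?thesis by (simp add: algebra_simps power2_eq_square)
qed

text \<open>
  Each of the \<open>k\<close> steps first moves with the current velocity for a time \<open>h\<close> and then switches with
  probability \<open>p\<close>; the value is the probability that the level \<open>\<beta>\<close> is never exceeded. In this order a rising particle
  keeps the exact value of \<open>c1 s - \<beta>\<close> (\<open>s\<close> the remaining time), on which side of \<open>0\<close> it lies being
  decisive: for a rising particle the probability has a jump there.
\<close>

fun walk_prob :: "real \<Rightarrow> real \<Rightarrow> real \<Rightarrow> real \<Rightarrow> nat \<Rightarrow> bool \<Rightarrow> real \<Rightarrow> real" where
  "walk_prob c1 c2 h p 0 up \<beta> = of_bool (0 \<le> \<beta>)"
| "walk_prob c1 c2 h p (Suc k) up \<beta> = (if \<beta> < 0 then 0 else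
     (1 - p) * walk_prob c1 c2 h p k up (\<beta> - h * (if up then c1 else - c2)) +
     p * walk_prob c1 c2 h p k (\<not> up) (\<beta> - h * (if up then c1 else - c2)))"

lemma walk_prob_neg: "\<beta> < 0 \<Longrightarrow> walk_prob c1 c2 h p k up \<beta> = 0"
  by (cases k) auto

lemma walk_prob_eq_1:
  assumes "c1 > 0" "c2 > 0" "h > 0"
  shows "c1 * h * real k \<le> \<beta> \<Longrightarrow> walk_prob c1 c2 h p k up \<beta> = 1"
proof (induction k arbitrary: up \<beta>)
  case (Suc k)
  have 0: "0 \<le> c1 * h * real k" "0 \<le> c1 * h" "0 \<le> c2 * h" using assms by auto
  have *: "c1 * h * real k + c1 * h \<le> \<beta>" using Suc.prems by (simp add: algebra_simps)
  have "c1 * h * real k \<le> \<beta> - h * (if up then c1 else - c2)"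
    using * 0 by (auto simp: algebra_simps)
  moreover have "\<not> \<beta> < 0" using * 0 by linarith
  ultimately show ?case using Suc.IH by simp
qed auto

text \<open>
  Induction over the steps. As long as no boundary is crossed, the error is averaged and increases by
  the consistency error \<open>O(\<delta>\<^sup>2)\<close>. Once a falling particle passes \<open>a = 0\<close> the discrete probability is
  exactly \<open>1\<close>, and once a rising one passes \<open>\<beta> = 0\<close> it is exactly \<open>0\<close>; the Lipschitz bound
  and the boundary values show that the error of that last step is at most \<open>L \<delta>\<close>. This term
  therefore enters once and not once per step.
\<close>

lemma walk_prob_approx:
  assumes pos: "c1 > 0" "c2 > 0" "lam > 0" "h > 0"
    and \<delta>: "\<delta> = lam * h" and \<rho>: "\<rho> = c2 / c1"
    and p: "0 \<le> p" "p \<le> 1" "\<bar>p - \<delta>\<bar> \<le> \<delta>\<^sup>2"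
    and L: "L \<ge> 0"
      "\<And>a b a' b'. a \<in> {0..R} \<Longrightarrow> b \<in> {0..R} \<Longrightarrow> a' \<in> {0..R} \<Longrightarrow> b' \<in> {0..R} \<Longrightarrow>
         \<bar>down_prob \<rho> a b - down_prob \<rho> a' b'\<bar> \<le> L * (\<bar>a - a'\<bar> + \<bar>b - b'\<bar>)"
      "\<And>a b a' b'. a \<in> {0..R} \<Longrightarrow> b \<in> {0..R} \<Longrightarrow> a' \<in> {0..R} \<Longrightarrow> b' \<in> {0..R} \<Longrightarrow>
         \<bar>up_prob \<rho> a b - up_prob \<rho> a' b'\<bar> \<le> L * (\<bar>a - a'\<bar> + \<bar>b - b'\<bar>)"
    and B: "\<And>a b. a \<in> {0..R} \<Longrightarrow> b \<in> {0..R} \<Longrightarrow> \<bar>up_prob \<rho> a b - down_prob \<rho> a b\<bar> \<le> B"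
  shows "\<lbrakk>\<beta> \<ge> 0; a > 0; lam * h * real k \<le> R;
      a = lam * (c1 * (h * real k) - \<beta>) / (c1 + c2); b = lam * (c2 * (h * real k) + \<beta>) / (c1 + c2)\<rbrakk>
    \<Longrightarrow> \<bar>walk_prob c1 c2 h p k up \<beta> - (if up then up_prob \<rho> a b else down_prob \<rho> a b)\<bar>
        \<le> L * \<delta> + real k * ((B + 2 * L) * \<delta>\<^sup>2)"
proof (induction k arbitrary: up \<beta> a b)
  case 0
  then have "a \<le> 0" using pos by (auto intro!: divide_nonpos_pos mult_nonneg_nonpos)
  with 0 show ?case by simp
next
  case (Suc k)
  let ?C = "B + 2 * L" and ?f = "walk_prob c1 c2 h p k"
  have \<delta>0: "\<delta> > 0" using pos \<delta> by simp
  have \<rho>0: "\<rho> \<ge> 0" using pos \<rho> by simp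
  have sum: "a + b = \<delta> * real (Suc k)" unfolding Suc.prems \<delta> using pos
    by (simp add: add_divide_distrib[symmetric] divide_simps) (simp add: algebra_simps)
  \<comment> \<open>within one upward step of its level, the point is within \<open>\<delta>\<close> of the line on which \<open>up_prob\<close> vanishes\<close>
  have barrier: "b - \<rho> * a = lam * \<beta> / c1" unfolding Suc.prems \<rho> using pos
    by (simp add: divide_simps) (simp add: algebra_simps)
  have b\<rho>: "\<rho> * a \<le> b" using barrier pos Suc.prems(1) by (simp add: diff_eq_eq)
  have \<rho>a: "0 \<le> \<rho> * a" using \<rho>0 Suc.prems(2) by simp
  have sumR: "a + b \<le> R" using sum Suc.prems(3) \<delta> by simp
  have aR: "a \<in> {0..R}" and bR: "b \<in> {0..R}" and \<rho>R: "\<rho> * a \<in> {0..R}"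
    using Suc.prems(2) b\<rho> \<rho>a sumR by auto
  have kR: "lam * h * real k \<le> R" using Suc.prems(3) pos
    by (intro order_trans[OF _ Suc.prems(3)] mult_left_mono) auto
  have B0: "B \<ge> 0" using B[OF aR bR] by linarith
  have E0: "L * \<delta> \<le> L * \<delta> + real (Suc k) * (?C * \<delta>\<^sup>2)" using B0 L(1) by simp
  have step: ?case
    if \<beta>: "\<beta>' = \<beta> - h * (if up then c1 else - c2)" "\<beta>' \<ge> 0" and a': "a' > 0"
      and ab: "a' = (if up then a else a - \<delta>)" "b' = (if up then b - \<delta> else b)"
      and cons: "\<bar>(1 - p) * (if up then up_prob \<rho> a' b' else down_prob \<rho> a' b') +
         p * (if \<not> up then up_prob \<rho> a' b' else down_prob \<rho> a' b') -
         (if up then up_prob \<rho> a b else down_prob \<rho> a b)\<bar> \<le> ?C * \<delta>\<^sup>2"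
    for \<beta>' a' b'
  proof -
    define E where "E = L * \<delta> + real k * (?C * \<delta>\<^sup>2)"
    have a'': "a' = lam * (c1 * (h * real k) - \<beta>') / (c1 + c2)"
      and b'': "b' = lam * (c2 * (h * real k) + \<beta>') / (c1 + c2)"
      using pos unfolding ab \<beta> Suc.prems \<delta> by (cases up; simp add: divide_simps, simp add: algebra_simps)+
    note IH = Suc.IH[OF \<beta>(2) a' kR a'' b'', folded E_def]
    let ?g = "\<lambda>up. if up then up_prob \<rho> a' b' else down_prob \<rho> a' b'"
    have "walk_prob c1 c2 h p (Suc k) up \<beta> = (1 - p) * ?f up \<beta>' + p * ?f (\<not> up) \<beta>'"
      using Suc.prems(1) \<beta> by simp
    then have "\<bar>walk_prob c1 c2 h p (Suc k) up \<beta> - (if up then up_prob \<rho> a b else down_prob \<rho> a b)\<bar> =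
      \<bar>(1 - p) * (?f up \<beta>' - ?g up) + p * (?f (\<not> up) \<beta>' - ?g (\<not> up)) +
       ((1 - p) * ?g up + p * ?g (\<not> up) - (if up then up_prob \<rho> a b else down_prob \<rho> a b))\<bar>"
      by (intro arg_cong[where f = abs]) (simp add: left_diff_distrib right_diff_distrib del: if_not_P if_P)
    also have "\<dots> \<le> \<bar>(1 - p) * (?f up \<beta>' - ?g up)\<bar> + \<bar>p * (?f (\<not> up) \<beta>' - ?g (\<not> up))\<bar> + ?C * \<delta>\<^sup>2"
      using cons by linarith
    also have "\<dots> \<le> (1 - p) * E + p * E + ?C * \<delta>\<^sup>2"
    proof -
      have "\<bar>(1 - p) * (?f up \<beta>' - ?g up)\<bar> \<le> (1 - p) * E"
        using mult_left_mono[OF IH[of up], of "1 - p"] p by (simp only: abs_mult abs_of_nonneg)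
      moreover have "\<bar>p * (?f (\<not> up) \<beta>' - ?g (\<not> up))\<bar> \<le> p * E"
        using mult_left_mono[OF IH[of "\<not> up"], of p] p by (simp only: abs_mult abs_of_nonneg)
      ultimately show ?thesis by linarith
    qed
    also have "\<dots> = L * \<delta> + real (Suc k) * (?C * \<delta>\<^sup>2)" by (simp add: E_def algebra_simps)
    finally show ?thesis .
  qed
  show ?case
  proof (cases up)
    case True
    show ?thesis
    proof (cases "\<beta> - h * c1 < 0")
      case dead: True
      have "\<bar>up_prob \<rho> a b\<bar> \<le> L * \<bar>b - \<rho> * a\<bar>"
        using L(3)[OF aR bR aR \<rho>R] by (simp add: up_prob_barrier)
      also have "b - \<rho> * a \<le> \<delta>" unfolding barrier \<delta> using pos dead by (simp add: field_simps)
      then have "L * \<bar>b - \<rho> * a\<bar> \<le> L * \<delta>" using b\<rho> L(1) by (intro mult_left_mono) auto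
      finally show ?thesis using True dead E0 by (simp add: walk_prob_neg)
    next
      case False
      have "\<delta> \<le> lam * \<beta> / c1" using False pos \<delta> by (simp add: pos_le_divide_eq mult_ac)
      then have "b - \<delta> \<ge> \<rho> * a" using barrier by linarith
      then have b'0: "b - \<delta> \<ge> 0" using \<rho>a by linarith
      have "\<bar>(1 - p) * up_prob \<rho> a (b - \<delta>) + p * down_prob \<rho> a (b - \<delta>) - up_prob \<rho> a b\<bar> \<le> ?C * \<delta>\<^sup>2"
      proof (rule one_step_consistency[OF up_prob_DERIV[OF \<rho>0] \<delta>0 p(3)])
        fix z assume z: "z \<in> {b - \<delta>..b}"
        have "z \<in> {0..R}" "b - \<delta> \<in> {0..R}" using z b'0 bR \<delta>0 by auto
        from L(2)[OF aR this(1) aR this(2)] L(3)[OF aR this(1) aR this(2)]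
        show "\<bar>(down_prob \<rho> a z - up_prob \<rho> a z) - (down_prob \<rho> a (b - \<delta>) - up_prob \<rho> a (b - \<delta>))\<bar>
          \<le> 2 * L * \<bar>z - (b - \<delta>)\<bar>" by simp
      next
        show "\<bar>down_prob \<rho> a (b - \<delta>) - up_prob \<rho> a (b - \<delta>)\<bar> \<le> B"
          using B[OF aR, of "b - \<delta>"] b'0 bR \<delta>0 by auto
      qed (use L(1) in auto)
      then show ?thesis using True False Suc.prems(2) by (intro step[OF refl _ _ refl refl]) auto
    qed
  next
    case down: False
    show ?thesis
    proof (cases "a - \<delta> \<le> 0")
      case True
      have "a - \<delta> = lam * (c1 * (h * real k) - (\<beta> + h * c2)) / (c1 + c2)"
        using pos unfolding Suc.prems \<delta> by (simp add: divide_simps) (simp add: algebra_simps)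
      then have "c1 * (h * real k) - (\<beta> + h * c2) \<le> 0"
        using True pos by (simp add: divide_le_0_iff mult_le_0_iff)
      then have "walk_prob c1 c2 h p k u (\<beta> + h * c2) = 1" for u
        using pos by (intro walk_prob_eq_1) (auto simp: algebra_simps)
      then have "walk_prob c1 c2 h p (Suc k) up \<beta> = 1" using down Suc.prems(1) by simp
      moreover have "\<bar>down_prob \<rho> 0 b - down_prob \<rho> a b\<bar> \<le> L * \<delta>"
      proof -
        have "\<bar>down_prob \<rho> 0 b - down_prob \<rho> a b\<bar> \<le> L * a"
          using L(2)[of 0 b a b] aR bR by simp
        also have "\<dots> \<le> L * \<delta>" using True L(1) by (intro mult_left_mono) auto
        finally show ?thesis .
      qed
      ultimately show ?thesis using down E0 by (simp add: down_prob_front)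
    next
      case False
      have "\<bar>(1 - p) * down_prob \<rho> (a - \<delta>) b + p * up_prob \<rho> (a - \<delta>) b - down_prob \<rho> a b\<bar> \<le> ?C * \<delta>\<^sup>2"
      proof (rule one_step_consistency[OF down_prob_DERIV[OF \<rho>0] \<delta>0 p(3)])
        fix z assume z: "z \<in> {a - \<delta>..a}"
        have "z \<in> {0..R}" "a - \<delta> \<in> {0..R}" using z False aR \<delta>0 by auto
        from L(2)[OF this(1) bR this(2) bR] L(3)[OF this(1) bR this(2) bR]
        show "\<bar>(up_prob \<rho> z b - down_prob \<rho> z b) - (up_prob \<rho> (a - \<delta>) b - down_prob \<rho> (a - \<delta>) b)\<bar>
          \<le> 2 * L * \<bar>z - (a - \<delta>)\<bar>" by simp
      next
        show "\<bar>up_prob \<rho> (a - \<delta>) b - down_prob \<rho> (a - \<delta>) b\<bar> \<le> B"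
          using B[of "a - \<delta>" b] False aR bR \<delta>0 by auto
      qed (use L(1) in auto)
      then show ?thesis using down False pos Suc.prems(1) by (intro step[OF refl _ _ refl refl]) auto
    qed
  qed
qed

text \<open>
  With \<open>n\<close> steps of length \<open>t / n\<close> the error bound is a constant divided by \<open>n\<close>. If \<open>\<beta> \<ge> c1 t\<close>, the
  level cannot be exceeded; the truncation \<open>max 0\<close> lets the limit take the value \<open>1\<close> in that case.
\<close>

lemma walk_prob_converges:
  assumes pos: "c1 > 0" "c2 > 0" "lam > 0" "t > 0" and \<beta>: "\<beta> \<ge> 0"
    and p: "\<And>n. 0 \<le> p n" "\<And>n. p n \<le> 1"
      "\<And>n. n > 0 \<Longrightarrow> \<bar>p n - lam * (t / real n)\<bar> \<le> (lam * (t / real n))\<^sup>2"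
  shows "(\<lambda>n. walk_prob c1 c2 (t / real n) (p n) n False \<beta>)
    \<longlonglongrightarrow> down_prob (c2 / c1) (max 0 (lam * (c1 * t - \<beta>) / (c1 + c2))) (lam * (c2 * t + \<beta>) / (c1 + c2))"
proof -
  define \<rho> where "\<rho> = c2 / c1"
  define a where "a = lam * (c1 * t - \<beta>) / (c1 + c2)"
  define b where "b = lam * (c2 * t + \<beta>) / (c1 + c2)"
  let ?R = "lam * t"
  have \<rho>0: "\<rho> \<ge> 0" using pos by (simp add: \<rho>_def)
  note D = exp_bounded_down_weight[OF \<rho>0] and U = exp_bounded_up_weight[OF \<rho>0]
  obtain L1 where L1: "L1 \<ge> 0" "\<And>a b a' b'. a \<in> {0..?R} \<Longrightarrow> b \<in> {0..?R} \<Longrightarrow> a' \<in> {0..?R} \<Longrightarrow> b' \<in> {0..?R} \<Longrightarrow>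
      \<bar>down_prob \<rho> a b - down_prob \<rho> a' b'\<bar> \<le> L1 * (\<bar>a - a'\<bar> + \<bar>b - b'\<bar>)"
    using poisson_mean_Lipschitz[OF D, of ?R] unfolding down_prob_def by blast
  obtain L2 where L2: "L2 \<ge> 0" "\<And>a b a' b'. a \<in> {0..?R} \<Longrightarrow> b \<in> {0..?R} \<Longrightarrow> a' \<in> {0..?R} \<Longrightarrow> b' \<in> {0..?R} \<Longrightarrow>
      \<bar>up_prob \<rho> a b - up_prob \<rho> a' b'\<bar> \<le> L2 * (\<bar>a - a'\<bar> + \<bar>b - b'\<bar>)"
    using poisson_mean_Lipschitz[OF U, of ?R] unfolding up_prob_def by blast
  obtain B1 where B1: "B1 \<ge> 0" "\<And>a b. a \<in> {0..?R} \<Longrightarrow> b \<in> {0..?R} \<Longrightarrow> \<bar>down_prob \<rho> a b\<bar> \<le> B1"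
    using poisson_mean_bounded[OF D, of ?R] unfolding down_prob_def by blast
  obtain B2 where B2: "B2 \<ge> 0" "\<And>a b. a \<in> {0..?R} \<Longrightarrow> b \<in> {0..?R} \<Longrightarrow> \<bar>up_prob \<rho> a b\<bar> \<le> B2"
    using poisson_mean_bounded[OF U, of ?R] unfolding up_prob_def by blast
  define L where "L = max L1 L2"
  have lip: "L \<ge> 0"
      "\<And>a b a' b'. a \<in> {0..?R} \<Longrightarrow> b \<in> {0..?R} \<Longrightarrow> a' \<in> {0..?R} \<Longrightarrow> b' \<in> {0..?R} \<Longrightarrow>
         \<bar>down_prob \<rho> a b - down_prob \<rho> a' b'\<bar> \<le> L * (\<bar>a - a'\<bar> + \<bar>b - b'\<bar>)"
      "\<And>a b a' b'. a \<in> {0..?R} \<Longrightarrow> b \<in> {0..?R} \<Longrightarrow> a' \<in> {0..?R} \<Longrightarrow> b' \<in> {0..?R} \<Longrightarrow>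
         \<bar>up_prob \<rho> a b - up_prob \<rho> a' b'\<bar> \<le> L * (\<bar>a - a'\<bar> + \<bar>b - b'\<bar>)"
  proof -
    show "L \<ge> 0" using L1(1) by (auto simp: L_def)
    fix a b a' b' assume "a \<in> {0..?R}" "b \<in> {0..?R}" "a' \<in> {0..?R}" "b' \<in> {0..?R}"
    note L1 = L1(2)[OF this] and L2 = L2(2)[OF this]
    have 1: "\<bar>down_prob \<rho> a b - down_prob \<rho> a' b'\<bar> \<le> L1 * (\<bar>a - a'\<bar> + \<bar>b - b'\<bar>)"
      and 2: "\<bar>up_prob \<rho> a b - up_prob \<rho> a' b'\<bar> \<le> L2 * (\<bar>a - a'\<bar> + \<bar>b - b'\<bar>)"
      by (fact L1, fact L2)
    show "\<bar>down_prob \<rho> a b - down_prob \<rho> a' b'\<bar> \<le> L * (\<bar>a - a'\<bar> + \<bar>b - b'\<bar>)"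
      by (rule order_trans[OF 1], intro mult_right_mono) (auto simp: L_def)
    show "\<bar>up_prob \<rho> a b - up_prob \<rho> a' b'\<bar> \<le> L * (\<bar>a - a'\<bar> + \<bar>b - b'\<bar>)"
      by (rule order_trans[OF 2], intro mult_right_mono) (auto simp: L_def)
  qed
  have B: "\<bar>up_prob \<rho> a b - down_prob \<rho> a b\<bar> \<le> B1 + B2" if "a \<in> {0..?R}" "b \<in> {0..?R}" for a b
  proof -
    have "\<bar>up_prob \<rho> a b\<bar> \<le> B2" "\<bar>down_prob \<rho> a b\<bar> \<le> B1" by (rule B2(2)[OF that], rule B1(2)[OF that])
    then show ?thesis by linarith
  qed
  let ?C = "L * (lam * t) + (B1 + B2 + 2 * L) * (lam * t)\<^sup>2"
  have bd: "norm (walk_prob c1 c2 (t / real n) (p n) n False \<beta> - down_prob \<rho> (max 0 a) b) \<le> ?C / real n"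
    if n: "n > 0" for n
  proof (cases "a > 0")
    case True
    let ?h = "t / real n"
    have hn: "?h * real n = t" using n by simp
    have "\<bar>walk_prob c1 c2 ?h (p n) n False \<beta> - (if False then up_prob \<rho> a b else down_prob \<rho> a b)\<bar>
        \<le> L * (lam * ?h) + real n * ((B1 + B2 + 2 * L) * (lam * ?h)\<^sup>2)"
      by (rule walk_prob_approx[OF pos(1-3) _ refl \<rho>_def p(1,2) p(3)[OF n] lip B \<beta> True])
        (use pos n hn in \<open>auto simp: a_def b_def\<close>)
    also have "\<dots> = ?C / real n" using n by (simp add: field_simps power2_eq_square)
    finally show ?thesis using True by simp
  next
    case False
    have "c1 * (t / real n) * real n \<le> \<beta>"
      using False pos n by (auto simp: a_def not_less divide_le_0_iff mult_le_0_iff)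
    then have "walk_prob c1 c2 (t / real n) (p n) n False \<beta> = 1"
      using pos n by (intro walk_prob_eq_1) auto
    moreover have "max 0 a = 0" using False by simp
    moreover have "0 \<le> ?C / real n"
      using lip(1) B1(1) B2(1) pos by (intro divide_nonneg_nonneg add_nonneg_nonneg mult_nonneg_nonneg) auto
    ultimately show ?thesis by (simp add: down_prob_front)
  qed
  have "(\<lambda>n. ?C / real n) \<longlonglongrightarrow> 0" by (rule lim_const_over_n)
  moreover have "\<forall>\<^sub>F n in sequentially. norm (walk_prob c1 c2 (t / real n) (p n) n False \<beta> - down_prob \<rho> (max 0 a) b) \<le> ?C / real n"
    using eventually_gt_at_top[of 0] by eventually_elim (rule bd)
  ultimately have "(\<lambda>n. walk_prob c1 c2 (t / real n) (p n) n False \<beta> - down_prob \<rho> (max 0 a) b) \<longlonglongrightarrow> 0"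
    by (rule Lim_null_comparison[rotated])
  then show ?thesis unfolding a_def b_def \<rho>_def by (rule LIM_zero_cancel)
qed

section \<open>The discretised walk\<close>

text \<open>
  The argument \<open>x\<close> lists the numbers of events in the successive intervals of length \<open>h\<close>, and \<open>up\<close> tells
  whether the walk starts with velocity \<open>c1\<close>. The inequality between truth values flips the initial
  direction when the number of events so far is odd.
\<close>

definition walk_below :: "real \<Rightarrow> real \<Rightarrow> real \<Rightarrow> nat \<Rightarrow> bool \<Rightarrow> real \<Rightarrow> (nat \<Rightarrow> nat) \<Rightarrow> bool" where
  "walk_below c1 c2 h k up \<beta> x \<longleftrightarrow>
     (\<forall>m\<le>k. (\<Sum>i<m. h * (if up \<noteq> odd (\<Sum>l<i. x l) then c1 else - c2)) \<le> \<beta>)"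

lemma walk_below_0: "walk_below c1 c2 h 0 up \<beta> x \<longleftrightarrow> 0 \<le> \<beta>"
  by (simp add: walk_below_def)

lemma walk_below_Suc:
  "walk_below c1 c2 h (Suc k) up \<beta> x \<longleftrightarrow> 0 \<le> \<beta> \<and>
     walk_below c1 c2 h k (up \<noteq> odd (x 0)) (\<beta> - h * (if up then c1 else - c2)) (\<lambda>l. x (Suc l))"
proof -
  let ?s = "\<lambda>up x m. \<Sum>i<m. h * (if up \<noteq> odd (\<Sum>l<i. x l) then c1 else - c2)"
  have parity: "(up \<noteq> odd (a + b)) = ((up \<noteq> odd a) \<noteq> odd b)" for a b :: nat
    by auto
  have "?s up x (Suc m) = h * (if up then c1 else - c2) + ?s (up \<noteq> odd (x 0)) (\<lambda>l. x (Suc l)) m" for m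
    unfolding sum.lessThan_Suc_shift parity by simp
  then have "(\<forall>m\<le>k. ?s up x (Suc m) \<le> \<beta>) \<longleftrightarrow>
      walk_below c1 c2 h k (up \<noteq> odd (x 0)) (\<beta> - h * (if up then c1 else - c2)) (\<lambda>l. x (Suc l))"
    unfolding walk_below_def by (simp only: le_diff_eq add.commute)
  moreover have "(\<forall>m\<le>Suc k. P m) \<longleftrightarrow> P 0 \<and> (\<forall>m\<le>k. P (Suc m))" for P :: "nat \<Rightarrow> bool"
    by (metis Suc_le_mono not0_implies_Suc zero_le)
  ultimately show ?thesis
    unfolding walk_below_def[of c1 c2 h "Suc k"] by simp
qed

text \<open>
  The recursion consumes the increments one after the other, whereas independence is available for
  events of the form \<open>X i \<in> A i\<close>. Carrying arbitrary such conditions on the first \<open>j\<close> increments makes the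
  induction work: splitting by the parity of \<open>X j\<close> merely adds one more condition.
\<close>

lemma (in prob_space) prob_prefix_and_walk_below:
  fixes X :: "nat \<Rightarrow> 'a \<Rightarrow> nat"
  assumes X: "indep_vars (\<lambda>_. count_space UNIV) X {..<n}"
    and p: "\<And>i. i < n \<Longrightarrow> \<P>(\<omega> in M. odd (X i \<omega>)) = p"
  shows "j + k = n \<Longrightarrow>
     {\<omega>\<in>space M. (\<forall>i<j. X i \<omega> \<in> A i) \<and> walk_below c1 c2 h k up \<beta> (\<lambda>l. X (j + l) \<omega>)} \<in> events \<and>
     \<P>(\<omega> in M. (\<forall>i<j. X i \<omega> \<in> A i) \<and> walk_below c1 c2 h k up \<beta> (\<lambda>l. X (j + l) \<omega>)) =
       (\<Prod>i<j. \<P>(\<omega> in M. X i \<omega> \<in> A i)) * walk_prob c1 c2 h p k up \<beta>"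
proof (induction k arbitrary: j A up \<beta>)
  case 0
  have meas: "X i \<in> measurable M (count_space UNIV)" if "i < n" for i
    using X that by (auto simp: indep_vars_def)
  have Xset: "X i -` A i \<inter> space M = {\<omega>\<in>space M. X i \<omega> \<in> A i}" for i
    by auto
  have ev1: "{\<omega>\<in>space M. X i \<omega> \<in> A i} \<in> events" if "i < j" for i
    using measurable_sets[OF meas, of i "A i"] that 0 unfolding Xset by simp
  have ev: "{\<omega>\<in>space M. \<forall>i<j. X i \<omega> \<in> A i} \<in> events"
    using sets.sets_Collect_finite_All[of "{..<j}" M "\<lambda>i \<omega>. X i \<omega> \<in> A i"] ev1 by simp
  have "prob {\<omega>\<in>space M. \<forall>i<j. X i \<omega> \<in> A i} = (\<Prod>i<j. \<P>(\<omega> in M. X i \<omega> \<in> A i))"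
  proof (cases "j = 0")
    case False
    have "{\<omega>\<in>space M. \<forall>i<j. X i \<omega> \<in> A i} = (\<Inter>i\<in>{..<j}. X i -` A i \<inter> space M)"
      using False by auto
    also have "prob \<dots> = (\<Prod>i\<in>{..<j}. prob (X i -` A i \<inter> space M))"
      using X by (rule indep_varsD) (use 0 False in auto)
    finally show ?thesis unfolding Xset .
  qed (simp add: prob_space)
  note base = ev this
  show ?case
  proof (cases "0 \<le> \<beta>")
    case True
    with base show ?thesis
      unfolding walk_below_0 walk_prob.simps by (simp only: simp_thms of_bool_eq mult_1_right)
  qed (simp add: walk_below_0)
next
  case (Suc k)
  show ?case
  proof (cases "\<beta> < 0")
    case True
    then show ?thesis by (simp add: walk_below_Suc)
  next
    case False
    define \<beta>' where "\<beta>' = \<beta> - h * (if up then c1 else - c2)"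
    \<comment> \<open>the set \<open>A j\<close> is free to be overwritten, since only the sets with index below \<open>j\<close> occur in the claim\<close>
    let ?A = "\<lambda>o'. A(j := {m. odd m = o'})"
    define E where "E o' = {\<omega>\<in>space M. (\<forall>i<Suc j. X i \<omega> \<in> ?A o' i) \<and>
      walk_below c1 c2 h k (up \<noteq> o') \<beta>' (\<lambda>l. X (Suc j + l) \<omega>)}" for o'
    have j: "j < n" "Suc j + k = n" using Suc.prems by auto
    have ev: "E o' \<in> events" for o'
      unfolding E_def using Suc.IH[OF j(2), of "?A o'"] by blast
    have Xj: "X j \<in> measurable M (count_space UNIV)"
      using X j by (auto simp: indep_vars_def)
    have odd_ev: "{\<omega>\<in>space M. odd (X j \<omega>)} \<in> events"
      using measurable_sets[OF Xj, of "{m. odd m}"] by (simp add: vimage_def Int_def conj_commute)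
    have "\<P>(\<omega> in M. odd (X j \<omega>) = False) = 1 - p"
      using prob_neg[OF odd_ev] p[OF j(1)] by simp
    then have parity: "\<P>(\<omega> in M. odd (X j \<omega>) = o') = (if o' then p else 1 - p)" for o'
      using p[OF j(1)] by (cases o') simp_all
    have pE: "prob (E o') = (\<Prod>i<j. \<P>(\<omega> in M. X i \<omega> \<in> A i)) *
        (if o' then p else 1 - p) * walk_prob c1 c2 h p k (up \<noteq> o') \<beta>'" for o'
    proof -
      have "prob (E o') = (\<Prod>i<Suc j. \<P>(\<omega> in M. X i \<omega> \<in> ?A o' i)) * walk_prob c1 c2 h p k (up \<noteq> o') \<beta>'"
        unfolding E_def using Suc.IH[OF j(2), of "?A o'"] by blast
      also have "(\<Prod>i<Suc j. \<P>(\<omega> in M. X i \<omega> \<in> ?A o' i)) =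
          (\<Prod>i<j. \<P>(\<omega> in M. X i \<omega> \<in> A i)) * \<P>(\<omega> in M. odd (X j \<omega>) = o')"
        by simp
      finally show ?thesis unfolding parity by simp
    qed
    have split: "{\<omega>\<in>space M. (\<forall>i<j. X i \<omega> \<in> A i) \<and> walk_below c1 c2 h (Suc k) up \<beta> (\<lambda>l. X (j + l) \<omega>)} =
        E True \<union> E False"
    proof (rule set_eqI)
      fix \<omega>
      show "\<omega> \<in> {\<omega>\<in>space M. (\<forall>i<j. X i \<omega> \<in> A i) \<and> walk_below c1 c2 h (Suc k) up \<beta> (\<lambda>l. X (j + l) \<omega>)} \<longleftrightarrow>
          \<omega> \<in> E True \<union> E False"
        unfolding E_def walk_below_Suc \<beta>'_def[symmetric] using False
        by (cases "odd (X j \<omega>)") (auto simp: less_Suc_eq)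
    qed
    have "E True \<inter> E False = {}" unfolding E_def by auto
    then have "prob (E True \<union> E False) = prob (E True) + prob (E False)"
      by (intro finite_measure_Union ev)
    then show ?thesis unfolding split using ev False
      by (auto simp: pE \<beta>'_def[symmetric] algebra_simps)
  qed
qed

lemma (in prob_space) prob_walk_below:
  fixes X :: "nat \<Rightarrow> 'a \<Rightarrow> nat"
  assumes "indep_vars (\<lambda>_. count_space UNIV) X {..<n}"
    and "\<And>i. i < n \<Longrightarrow> \<P>(\<omega> in M. odd (X i \<omega>)) = p"
  shows "\<P>(\<omega> in M. walk_below c1 c2 h n up \<beta> (\<lambda>l. X l \<omega>)) = walk_prob c1 c2 h p n up \<beta>"
  using prob_prefix_and_walk_below[OF assms, of 0 n] by simp

text \<open>
  The odd numbers contain \<open>1\<close> and omit \<open>0\<close>, and the probabilities of these two values are explicit.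
\<close>

lemma poisson_odd_prob:
  assumes "\<delta> > 0"
  shows "\<bar>measure (measure_pmf (poisson_pmf \<delta>)) {m. odd m} - \<delta>\<bar> \<le> \<delta>\<^sup>2"
proof -
  let ?P = "measure (measure_pmf (poisson_pmf \<delta>))"
  have "\<delta> - \<delta>\<^sup>2 \<le> \<delta> * exp (- \<delta>)"
    using mult_left_mono[OF exp_ge_add_one_self[of "- \<delta>"], of \<delta>] assms
    by (simp add: algebra_simps power2_eq_square)
  also have "\<dots> = ?P {1}" using assms by (simp add: measure_pmf_single)
  also have "\<dots> \<le> ?P {m. odd m}"
    by (intro measure_pmf.finite_measure_mono) auto
  finally have lower: "\<delta> - \<delta>\<^sup>2 \<le> ?P {m. odd m}" .
  have "?P {m. odd m} \<le> ?P (UNIV - {0})"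
    by (intro measure_pmf.finite_measure_mono) (auto intro: Suc_leI odd_pos)
  also have "\<dots> = 1 - exp (- \<delta>)"
    using measure_pmf.prob_compl[of "{0}" "poisson_pmf \<delta>"] assms
    by (simp add: measure_pmf_single)
  also have "\<dots> \<le> \<delta>" using exp_ge_add_one_self[of "- \<delta>"] by simp
  finally show ?thesis using lower by (simp add: abs_le_iff power2_eq_square)
qed

section \<open>Comparing the path with its discretisation\<close>

text \<open>
  Here \<open>f\<close> counts the events; since the start is downwards, an odd count means that the particle rises.
\<close>

definition down_path :: "real \<Rightarrow> real \<Rightarrow> (real \<Rightarrow> nat) \<Rightarrow> real \<Rightarrow> real" where
  "down_path c1 c2 f s = integral {0..s} (\<lambda>s. if odd (f s) then c1 else - c2)"

context
  fixes c1 c2 :: real and f :: "real \<Rightarrow> nat"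
  assumes pos: "c1 > 0" "c2 > 0" and mono: "mono_on {0..} f"
begin

text \<open>
  A bounded function that factors through a monotone, hence measurable, function.
\<close>

lemma parity_integrable:
  assumes "0 \<le> a"
  shows "(\<lambda>s. if odd (f s) then c1 else - c2) integrable_on {a..b}"
proof -
  let ?F = "\<lambda>s. real (f (max 0 s))"
  let ?V = "\<lambda>s. if odd (nat \<lfloor>?F s\<rfloor>) then c1 else - c2"
  have "mono ?F"
    using mono by (intro monoI) (auto simp: mono_on_def)
  then have "?F \<in> borel_measurable borel" by (rule borel_measurable_mono)
  then have "(\<lambda>s. \<lfloor>?F s\<rfloor>) \<in> measurable borel (count_space UNIV)"
    by (rule measurable_compose[OF _ measurable_real_floor])
  then have "?V \<in> borel_measurable borel"
    by (rule measurable_compose[where N = "count_space UNIV"]) simp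
  then have "?V \<in> borel_measurable (lebesgue_on {a..b})"
    by (intro measurable_restrict_space1 measurable_completion) simp
  then have "?V integrable_on {a..b}"
    by (rule measurable_bounded_by_integrable_imp_integrable[where g = "\<lambda>_. c1 + c2"])
      (use pos in auto)
  then show ?thesis
    by (rule integrable_eq) (use assms in \<open>auto simp: max_def\<close>)
qed

lemma down_path_diff:
  assumes "0 \<le> a" "a \<le> b"
  shows "down_path c1 c2 f b - down_path c1 c2 f a = integral {a..b} (\<lambda>s. if odd (f s) then c1 else - c2)"
  unfolding down_path_def
  using Henstock_Kurzweil_Integration.integral_combine[OF assms parity_integrable[OF order_refl]] by linarith

lemma down_path_increment_bound:
  assumes "0 \<le> a" "a \<le> b" and e: "- c2 \<le> e" "e \<le> c1"
  shows "\<bar>down_path c1 c2 f b - down_path c1 c2 f a - (b - a) * e\<bar> \<le> (c1 + c2) * (b - a)"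
proof -
  let ?v = "\<lambda>s. if odd (f s) then c1 else - c2"
  note int = parity_integrable[OF assms(1), of b]
  have "norm (integral {a..b} (\<lambda>s. ?v s - e)) \<le> integral {a..b} (\<lambda>_. c1 + c2)"
    by (rule integral_norm_bound_integral) (use int e pos in \<open>auto intro!: integrable_diff\<close>)
  moreover have "integral {a..b} (\<lambda>s. ?v s - e) = integral {a..b} ?v - (b - a) * e"
    using assms by (subst Henstock_Kurzweil_Integration.integral_diff[OF int]) auto
  ultimately show ?thesis
    using assms by (simp add: down_path_diff mult.commute)
qed

text \<open>
  On an interval without an event the frozen velocity is the true one. On any other interval the error
  is at most \<open>(c1 + c2) h\<close>, and \<open>f\<close> increases there by at least \<open>1\<close>.
\<close>

lemma down_path_grid_error:
  assumes "h \<ge> 0"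
  shows "\<bar>down_path c1 c2 f (real m * h) - (\<Sum>i<m. h * (if odd (f (real i * h)) then c1 else - c2))\<bar>
    \<le> (c1 + c2) * h * real (f (real m * h))"
proof (induction m)
  case 0
  then show ?case using pos assms by (simp add: down_path_def)
next
  case (Suc m)
  let ?a = "real m * h" and ?b = "real (Suc m) * h"
  let ?v = "\<lambda>s. if odd (f s) then c1 else - c2"
  have ab: "0 \<le> ?a" "?a \<le> ?b" "?b - ?a = h" using assms by (auto simp: algebra_simps)
  have fab: "f ?a \<le> f ?b" using ab mono by (auto intro: mono_onD)
  have "\<bar>down_path c1 c2 f ?b - down_path c1 c2 f ?a - h * ?v ?a\<bar>
      \<le> (c1 + c2) * h * (real (f ?b) - real (f ?a))"
  proof (cases "f ?a = f ?b")
    case True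
    have "integral {?a..?b} ?v = integral {?a..?b} (\<lambda>_. ?v ?a)"
    proof (rule Henstock_Kurzweil_Integration.integral_cong)
      fix s assume s: "s \<in> {?a..?b}"
      then have "f ?a \<le> f s" "f s \<le> f ?b" using ab(1) mono by (auto intro!: mono_onD[OF mono])
      then show "?v s = ?v ?a" using True by simp
    qed
    also have "\<dots> = h * ?v ?a" using ab by simp
    finally show ?thesis using down_path_diff[OF ab(1,2)] True by simp
  next
    case False
    then have "1 \<le> real (f ?b) - real (f ?a)" using fab by linarith
    then have "(c1 + c2) * h * 1 \<le> (c1 + c2) * h * (real (f ?b) - real (f ?a))"
      using pos assms by (intro mult_left_mono) auto
    moreover have "- c2 \<le> ?v ?a" "?v ?a \<le> c1" using pos by auto
    note down_path_increment_bound[OF ab(1,2) this, unfolded ab(3)]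
    ultimately show ?thesis by linarith
  qed
  then show ?case using Suc by (simp add: algebra_simps)
qed

lemma down_path_bdd_above: "bdd_above (down_path c1 c2 f ` {0..t})"
proof (rule bdd_aboveI2)
  fix s assume s: "s \<in> {0..t}"
  have "down_path c1 c2 f s \<le> (c1 + c2) * s"
    using down_path_increment_bound[of 0 s 0] s pos by (simp add: down_path_def)
  also have "\<dots> \<le> (c1 + c2) * t" using s pos by (intro mult_left_mono) auto
  finally show "down_path c1 c2 f s \<le> (c1 + c2) * t" .
qed

lemma walk_below_parity:
  assumes f0: "f 0 = 0" and h: "h \<ge> 0"
  shows "walk_below c1 c2 h n False \<beta> (\<lambda>l. f (real (Suc l) * h) - f (real l * h)) \<longleftrightarrow>
     (\<forall>m\<le>n. (\<Sum>i<m. h * (if odd (f (real i * h)) then c1 else - c2)) \<le> \<beta>)"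
proof -
  have "(\<Sum>l<i. f (real (Suc l) * h) - f (real l * h)) = f (real i * h)" for i
  proof (induction i)
    case (Suc i)
    have "f (real i * h) \<le> f (real (Suc i) * h)"
      using h by (intro mono_onD[OF mono]) (auto intro!: mult_right_mono)
    with Suc show ?case by (simp del: of_nat_Suc)
  qed (simp add: f0)
  then show ?thesis unfolding walk_below_def by (simp only: simp_thms)
qed

text \<open>
  The summand \<open>1\<close> in the error bound accounts for times between two grid points, which the converse
  implication below rounds down.
\<close>

lemma walk_below_of_sup_le:
  assumes f0: "f 0 = 0" and t: "t > 0" and n: "n > 0"
    and le: "(SUP s\<in>{0..t}. down_path c1 c2 f s) \<le> \<beta>"
    and err: "(c1 + c2) * (t / real n) * (real (f t) + 1) \<le> \<epsilon>"
  shows "walk_below c1 c2 (t / real n) n False (\<beta> + \<epsilon>)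
           (\<lambda>l. f (real (Suc l) * (t / real n)) - f (real l * (t / real n)))"
proof -
  let ?h = "t / real n"
  have h: "?h \<ge> 0" using t by simp
  have "(\<Sum>i<m. ?h * (if odd (f (real i * ?h)) then c1 else - c2)) \<le> \<beta> + \<epsilon>" if m: "m \<le> n" for m
  proof -
    have mt: "0 \<le> real m * ?h" "real m * ?h \<le> t"
      using m n t mult_right_mono[OF of_nat_mono[OF m], of ?h] by auto
    have "down_path c1 c2 f (real m * ?h) \<le> (SUP s\<in>{0..t}. down_path c1 c2 f s)"
      using mt by (intro cSUP_upper down_path_bdd_above) auto
    moreover have "(c1 + c2) * ?h * real (f (real m * ?h)) \<le> (c1 + c2) * ?h * (real (f t) + 1)"
      using mt pos h mono_onD[OF mono, of "real m * ?h" t] by (intro mult_left_mono) auto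
    ultimately show ?thesis using down_path_grid_error[OF h, of m] le err by linarith
  qed
  then show ?thesis unfolding walk_below_parity[OF f0 h] by blast
qed

lemma sup_le_of_walk_below:
  assumes f0: "f 0 = 0" and t: "t > 0" and n: "n > 0"
    and below: "walk_below c1 c2 (t / real n) n False \<beta>
           (\<lambda>l. f (real (Suc l) * (t / real n)) - f (real l * (t / real n)))"
    and err: "(c1 + c2) * (t / real n) * (real (f t) + 1) \<le> \<epsilon>"
  shows "(SUP s\<in>{0..t}. down_path c1 c2 f s) \<le> \<beta> + \<epsilon>"
proof (rule cSUP_least)
  fix s assume s: "s \<in> {0..t}"
  let ?h = "t / real n"
  have h: "?h > 0" using t n by simp
  define m where "m = nat \<lfloor>s / ?h\<rfloor>"
  have "real m = of_int \<lfloor>s / ?h\<rfloor>" using s h by (simp add: m_def)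
  then have "real m \<le> s / ?h" "s / ?h < real m + 1"
    using of_int_floor_le[of "s / ?h"] floor_correct[of "s / ?h"] by auto
  then have "real m * ?h \<le> s" "s < (real m + 1) * ?h"
    unfolding pos_le_divide_eq[OF h] pos_divide_less_eq[OF h] .
  then have ms: "real m * ?h \<le> s" "s - real m * ?h \<le> ?h"
    unfolding distrib_right by linarith+
  have "real m * ?h \<le> real n * ?h" using ms(1) s n by simp
  then have mn: "m \<le> n" using h by (simp only: mult_le_cancel_right_pos of_nat_le_iff)
  have mt: "0 \<le> real m * ?h" "real m * ?h \<le> t" using ms s h by auto
  have "down_path c1 c2 f s - down_path c1 c2 f (real m * ?h) \<le> (c1 + c2) * (s - real m * ?h)"
    using down_path_increment_bound[OF mt(1) ms(1), of 0] pos by simp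
  also have "\<dots> \<le> (c1 + c2) * ?h" using ms pos by (intro mult_left_mono) auto
  finally have 1: "down_path c1 c2 f s - down_path c1 c2 f (real m * ?h) \<le> (c1 + c2) * ?h" .
  have 2: "down_path c1 c2 f (real m * ?h) \<le>
      (\<Sum>i<m. ?h * (if odd (f (real i * ?h)) then c1 else - c2)) + (c1 + c2) * ?h * real (f (real m * ?h))"
    using down_path_grid_error[of ?h m] h by linarith
  have 3: "(c1 + c2) * ?h * real (f (real m * ?h)) \<le> (c1 + c2) * ?h * real (f t)"
    using mt pos h mono_onD[OF mono, of "real m * ?h" t] by (intro mult_left_mono) auto
  have 4: "(\<Sum>i<m. ?h * (if odd (f (real i * ?h)) then c1 else - c2)) \<le> \<beta>"
    using below mn h unfolding walk_below_parity[OF f0 less_imp_le[OF h]] by blast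
  have "(c1 + c2) * ?h * (real (f t) + 1) = (c1 + c2) * ?h * real (f t) + (c1 + c2) * ?h"
    by (simp add: distrib_left)
  then show "down_path c1 c2 f s \<le> \<beta> + \<epsilon>" using 1 2 3 4 err by linarith
qed (use t in auto)

end

section \<open>The law of the maximum after a descending start\<close>

lemma (in prob_space) poisson_walk_prob:
  assumes PP: "poisson_process M lam N" and pos: "lam > 0" "h > 0"
  shows "\<P>(\<omega> in M. walk_below c1 c2 h n up \<beta> (\<lambda>l. N (real (Suc l) * h) \<omega> - N (real l * h) \<omega>)) =
    walk_prob c1 c2 h (measure (measure_pmf (poisson_pmf (lam * h))) {m. odd m}) n up \<beta>"
proof (rule prob_walk_below[where X = "\<lambda>l \<omega>. N (real (Suc l) * h) \<omega> - N (real l * h) \<omega>"])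
  have mono: "real i * h \<le> real (Suc i) * h" for i using pos by (intro mult_right_mono) auto
  have "\<And>(n::nat) \<tau>. 0 \<le> \<tau> 0 \<Longrightarrow> (\<forall>i<n. \<tau> i \<le> \<tau> (Suc i)) \<Longrightarrow>
      indep_vars (\<lambda>_. count_space UNIV) (\<lambda>i \<omega>. N (\<tau> (Suc i)) \<omega> - N (\<tau> i) \<omega>) {..<n}"
    and law: "\<And>s u. 0 \<le> s \<Longrightarrow> s < u \<Longrightarrow> distr M (count_space UNIV) (\<lambda>\<omega>. N u \<omega> - N s \<omega>) =
      measure_pmf (poisson_pmf (lam * (u - s)))"
    using PP unfolding poisson_process_def by simp_all
  from this(1)[of "\<lambda>i. real i * h" n]
  show ind: "indep_vars (\<lambda>_. count_space UNIV) (\<lambda>l \<omega>. N (real (Suc l) * h) \<omega> - N (real l * h) \<omega>) {..<n}"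
    using mono pos by (simp del: of_nat_Suc)
  fix i assume i: "i < n"
  let ?X = "\<lambda>\<omega>. N (real (Suc i) * h) \<omega> - N (real i * h) \<omega>"
  have X: "?X \<in> measurable M (count_space UNIV)"
    using ind i by (auto simp: indep_vars_def)
  have "distr M (count_space UNIV) ?X =
      measure_pmf (poisson_pmf (lam * (real (Suc i) * h - real i * h)))"
    using pos by (intro law) auto
  also have "real (Suc i) * h - real i * h = h" by (simp add: algebra_simps)
  finally have "measure (measure_pmf (poisson_pmf (lam * h))) {m. odd m} =
      measure (distr M (count_space UNIV) ?X) {m. odd m}" by simp
  also have "\<dots> = \<P>(\<omega> in M. odd (?X \<omega>))"
    by (subst measure_distr[OF X]) (auto simp: vimage_def Int_def conj_commute)
  finally show "\<P>(\<omega> in M. odd (?X \<omega>)) = measure (measure_pmf (poisson_pmf (lam * h))) {m. odd m}" ..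
qed

lemma walk_below_measurable:
  assumes N: "\<And>s. s \<ge> 0 \<Longrightarrow> N s \<in> measurable S (count_space UNIV)"
    and path: "\<And>\<omega>. \<omega> \<in> space S \<Longrightarrow> N 0 \<omega> = 0 \<and> mono_on {0..} (\<lambda>s. N s \<omega>)"
    and pos: "c1 > 0" "c2 > 0" "h \<ge> 0"
  shows "{\<omega>\<in>space S. walk_below c1 c2 h n False \<beta> (\<lambda>l. N (real (Suc l) * h) \<omega> - N (real l * h) \<omega>)} \<in> sets S"
proof -
  have V [measurable]: "(\<lambda>\<omega>. if odd (N (real i * h) \<omega>) then c1 else - c2) \<in> borel_measurable S" for i
  proof -
    have "N (real i * h) \<in> measurable S (count_space UNIV)" using N pos by simp
    from measurable_compose[OF this, of "\<lambda>k. if odd k then c1 else - c2" borel]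
    show ?thesis by simp
  qed
  have "{\<omega>\<in>space S. walk_below c1 c2 h n False \<beta> (\<lambda>l. N (real (Suc l) * h) \<omega> - N (real l * h) \<omega>)} =
    {\<omega>\<in>space S. \<forall>m\<le>n. (\<Sum>i<m. h * (if odd (N (real i * h) \<omega>) then c1 else - c2)) \<le> \<beta>}"
  proof (intro Collect_cong conj_cong refl)
    fix \<omega> assume "\<omega> \<in> space S"
    note p = path[OF this]
    show "walk_below c1 c2 h n False \<beta> (\<lambda>l. N (real (Suc l) * h) \<omega> - N (real l * h) \<omega>) \<longleftrightarrow>
      (\<forall>m\<le>n. (\<Sum>i<m. h * (if odd (N (real i * h) \<omega>) then c1 else - c2)) \<le> \<beta>)"
      by (rule walk_below_parity[OF pos(1,2) conjunct2[OF p] conjunct1[OF p] pos(3)])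
  qed
  also have "\<dots> \<in> sets S" by measurable
  finally show ?thesis .
qed

text \<open>
  The supremum is at most \<open>\<beta>\<close> iff, for every \<open>k\<close>, all sufficiently fine discretised walks stay below
  \<open>\<beta> + 1/(k + 1)\<close>; this is a countable combination of conditions on finitely many values of \<open>N\<close>. The
  sigma-algebra \<open>S\<close> is left open because independence of the initial velocity requires the one
  generated by \<open>N\<close>.
\<close>

lemma sup_down_path_measurable:
  assumes N: "\<And>s. s \<ge> 0 \<Longrightarrow> N s \<in> measurable S (count_space UNIV)"
    and path: "\<And>\<omega>. \<omega> \<in> space S \<Longrightarrow> N 0 \<omega> = 0 \<and> mono_on {0..} (\<lambda>s. N s \<omega>)"
    and pos: "c1 > 0" "c2 > 0" "t > 0"
  shows "{\<omega>\<in>space S. (SUP s\<in>{0..t}. down_path c1 c2 (\<lambda>s. N s \<omega>) s) \<le> \<beta>} \<in> sets S"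
proof -
  let ?h = "\<lambda>n. t / real (Suc n)"
  define G where "G n b \<omega> \<longleftrightarrow> walk_below c1 c2 (?h n) (Suc n) False b
    (\<lambda>l. N (real (Suc l) * ?h n) \<omega> - N (real l * ?h n) \<omega>)" for n b \<omega>
  have G_meas [measurable]: "Measurable.pred S (G n b)" for n b
    unfolding pred_def G_def by (rule walk_below_measurable[OF N path pos(1,2)]) (use pos in auto)
  have "(SUP s\<in>{0..t}. down_path c1 c2 (\<lambda>s. N s \<omega>) s) \<le> \<beta> \<longleftrightarrow>
      (\<forall>k. \<exists>n0. \<forall>n\<ge>n0. G n (\<beta> + 1 / real (Suc k)) \<omega>)" if \<omega>: "\<omega> \<in> space S" for \<omega>
  proof -
    note f = pos(1,2) conjunct2[OF path[OF \<omega>]] conjunct1[OF path[OF \<omega>]] pos(3) zero_less_Suc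
    have "(\<lambda>n. (c1 + c2) * (t / real (Suc n)) * (real (N t \<omega>) + 1)) \<longlonglongrightarrow> (c1 + c2) * 0 * (real (N t \<omega>) + 1)"
      by (intro tendsto_intros LIMSEQ_Suc[OF lim_const_over_n])
    then have err: "\<forall>\<^sub>F n in sequentially. (c1 + c2) * (t / real (Suc n)) * (real (N t \<omega>) + 1) < e" if "e > 0" for e
      using that by (intro order_tendstoD) auto
    show ?thesis
    proof
      assume le: "(SUP s\<in>{0..t}. down_path c1 c2 (\<lambda>s. N s \<omega>) s) \<le> \<beta>"
      show "\<forall>k. \<exists>n0. \<forall>n\<ge>n0. G n (\<beta> + 1 / real (Suc k)) \<omega>"
      proof
        fix k
        have "\<forall>\<^sub>F n in sequentially. G n (\<beta> + 1 / real (Suc k)) \<omega>"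
        proof (rule eventually_mono[OF err[of "1 / real (Suc k)"]])
          fix n assume "(c1 + c2) * (t / real (Suc n)) * (real (N t \<omega>) + 1) < 1 / real (Suc k)"
          from walk_below_of_sup_le[OF f le less_imp_le[OF this]]
          show "G n (\<beta> + 1 / real (Suc k)) \<omega>" unfolding G_def .
        qed simp
        then show "\<exists>n0. \<forall>n\<ge>n0. G n (\<beta> + 1 / real (Suc k)) \<omega>"
          by (simp add: eventually_sequentially)
      qed
    next
      assume G: "\<forall>k. \<exists>n0. \<forall>n\<ge>n0. G n (\<beta> + 1 / real (Suc k)) \<omega>"
      show "(SUP s\<in>{0..t}. down_path c1 c2 (\<lambda>s. N s \<omega>) s) \<le> \<beta>"
      proof (rule field_le_epsilon)
        fix e :: real assume "e > 0"
        then obtain k where k: "1 / real (Suc k) < e / 2"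
          using reals_Archimedean[of "e / 2"] by (auto simp: inverse_eq_divide)
        have ev: "\<forall>\<^sub>F n in sequentially. G n (\<beta> + 1 / real (Suc k)) \<omega>"
          using G by (simp add: eventually_sequentially)
        have "\<forall>\<^sub>F n in sequentially. G n (\<beta> + 1 / real (Suc k)) \<omega> \<and>
            (c1 + c2) * (t / real (Suc n)) * (real (N t \<omega>) + 1) < e / 2"
          by (intro eventually_conj ev err) (use \<open>e > 0\<close> in simp)
        from eventually_happens'[OF sequentially_bot this] obtain n where n: "G n (\<beta> + 1 / real (Suc k)) \<omega>"
            "(c1 + c2) * (t / real (Suc n)) * (real (N t \<omega>) + 1) \<le> e / 2"
          by (auto intro: less_imp_le)
        from sup_le_of_walk_below[OF f n[unfolded G_def]] k
        show "(SUP s\<in>{0..t}. down_path c1 c2 (\<lambda>s. N s \<omega>) s) \<le> \<beta> + e" by simp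
      qed
    qed
  qed
  then have "{\<omega>\<in>space S. (SUP s\<in>{0..t}. down_path c1 c2 (\<lambda>s. N s \<omega>) s) \<le> \<beta>} =
    {\<omega>\<in>space S. \<forall>k. \<exists>n0. \<forall>n\<ge>n0. G n (\<beta> + 1 / real (Suc k)) \<omega>}"
    by auto
  also have "\<dots> \<in> sets S" by measurable
  finally show ?thesis .
qed

lemma (in prob_space) poisson_tail_tendsto_0:
  fixes X :: "'a \<Rightarrow> nat"
  assumes X: "X \<in> measurable M (count_space UNIV)" and e: "e > 0" and K: "K \<ge> 0"
  shows "(\<lambda>n. \<P>(\<omega> in M. e < K / real (Suc n) * (real (X \<omega>) + 1))) \<longlonglongrightarrow> 0"
proof -
  let ?A = "\<lambda>n. {\<omega>\<in>space M. e < K / real (Suc n) * (real (X \<omega>) + 1)}"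
  have meas: "?A n \<in> events" for n
    using X by measurable
  have "decseq ?A"
  proof (rule decseq_SucI, safe)
    fix n \<omega> assume "e < K / real (Suc (Suc n)) * (real (X \<omega>) + 1)"
    also have "\<dots> \<le> K / real (Suc n) * (real (X \<omega>) + 1)"
      using K by (intro mult_right_mono divide_left_mono) auto
    finally show "e < K / real (Suc n) * (real (X \<omega>) + 1)" .
  qed
  then have "(\<lambda>n. prob (?A n)) \<longlonglongrightarrow> prob (\<Inter>n. ?A n)"
    using meas by (intro finite_Lim_measure_decseq) auto
  moreover have "(\<Inter>n. ?A n) = {}"
  proof -
    have "\<exists>n. \<not> e < K / real (Suc n) * (real (X \<omega>) + 1)" for \<omega>
    proof -
      have "(\<lambda>n. K / real (Suc n) * (real (X \<omega>) + 1)) \<longlonglongrightarrow> 0 * (real (X \<omega>) + 1)"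
        by (intro tendsto_intros LIMSEQ_Suc[OF lim_const_over_n])
      then have "\<forall>\<^sub>F n in sequentially. K / real (Suc n) * (real (X \<omega>) + 1) < e"
        using e by (intro order_tendstoD) auto
      from eventually_happens'[OF sequentially_bot this] show ?thesis by (metis less_asym)
    qed
    then show ?thesis by blast
  qed
  ultimately show ?thesis by simp
qed

text \<open>
  Outside the event \<open>A n e\<close>, whose probability tends to \<open>0\<close>, the discretisation error is at most \<open>e\<close>.
  Therefore \<open>prob (E b) \<le> F (b + e)\<close> and \<open>F b \<le> prob (E (b + e))\<close>. As \<open>e\<close> tends to \<open>0\<close>, the first
  inequality uses continuity of \<open>F\<close> from the right and the second one the same property of the distribution
  function. Limits are taken from the right only, so the atom of the maximum at \<open>0\<close> does no harm.
\<close>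

lemma (in prob_space) prob_sup_down_path_le:
  assumes PP: "poisson_process M lam N" and pos: "c1 > 0" "c2 > 0" "lam > 0" "t > 0" and \<beta>: "\<beta> \<ge> 0"
  shows "\<P>(\<omega> in M. (SUP s\<in>{0..t}. down_path c1 c2 (\<lambda>s. N s \<omega>) s) \<le> \<beta>) =
    down_prob (c2 / c1) (max 0 (lam * (c1 * t - \<beta>) / (c1 + c2))) (lam * (c2 * t + \<beta>) / (c1 + c2))"
proof -
  have N: "\<And>s. s \<ge> 0 \<Longrightarrow> N s \<in> measurable M (count_space UNIV)"
    and path: "\<And>\<omega>. \<omega> \<in> space M \<Longrightarrow> N 0 \<omega> = 0 \<and> mono_on {0..} (\<lambda>s. N s \<omega>)"
    using PP by (auto simp: poisson_process_def)
  let ?h = "\<lambda>n. t / real (Suc n)"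
  define F where "F b = down_prob (c2 / c1) (max 0 (lam * (c1 * t - b) / (c1 + c2))) (lam * (c2 * t + b) / (c1 + c2))" for b
  define E where "E b = {\<omega>\<in>space M. (SUP s\<in>{0..t}. down_path c1 c2 (\<lambda>s. N s \<omega>) s) \<le> b}" for b
  define G where "G n b = {\<omega>\<in>space M. walk_below c1 c2 (?h n) (Suc n) False b
    (\<lambda>l. N (real (Suc l) * ?h n) \<omega> - N (real l * ?h n) \<omega>)}" for n b
  define A where "A n e = {\<omega>\<in>space M. e < (c1 + c2) * t / real (Suc n) * (real (N t \<omega>) + 1)}" for n e
  have E_ev: "E b \<in> events" for b
    unfolding E_def by (rule sup_down_path_measurable[OF N path pos(1,2,4)])
  have G_ev: "G n b \<in> events" for n b
    unfolding G_def by (rule walk_below_measurable[OF N path pos(1,2)]) (use pos in auto)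
  have A_ev: "A n e \<in> events" for n e
  proof -
    have [measurable]: "N t \<in> measurable M (count_space UNIV)" using N pos by simp
    show ?thesis unfolding A_def by measurable
  qed
  have A_lim: "(\<lambda>n. prob (A n e)) \<longlonglongrightarrow> 0" if "e > 0" for e
    unfolding A_def using poisson_tail_tendsto_0[OF N[of t] that, of "(c1 + c2) * t"] pos by simp
  let ?p = "\<lambda>n. measure (measure_pmf (poisson_pmf (lam * (t / real n)))) {m. odd m}"
  have G_lim: "(\<lambda>n. prob (G n b)) \<longlonglongrightarrow> F b" if "b \<ge> 0" for b
  proof -
    have "(\<lambda>n. walk_prob c1 c2 (t / real n) (?p n) n False b) \<longlonglongrightarrow> F b"
      unfolding F_def
      by (rule walk_prob_converges[OF pos that]) (use pos in \<open>auto intro!: poisson_odd_prob\<close>)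
    then have "(\<lambda>n. walk_prob c1 c2 (?h n) (?p (Suc n)) (Suc n) False b) \<longlonglongrightarrow> F b"
      by (rule LIMSEQ_Suc)
    moreover have "prob (G n b) = walk_prob c1 c2 (?h n) (?p (Suc n)) (Suc n) False b" for n
      unfolding G_def by (rule poisson_walk_prob[OF PP pos(3)]) (use pos in simp)
    ultimately show ?thesis by simp
  qed
  have err: "(c1 + c2) * ?h n * (real (N t \<omega>) + 1) \<le> e" if "\<omega> \<in> space M" "\<omega> \<notin> A n e" for n \<omega> e
    using that by (simp add: A_def not_less)
  have upper: "prob (E b) \<le> F (b + e)" if "b \<ge> 0" "e > 0" for b e
  proof -
    have "prob (E b) \<le> prob (G n (b + e)) + prob (A n e)" for n
    proof -
      have "E b \<subseteq> G n (b + e) \<union> A n e"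
      proof
        fix \<omega> assume \<omega>: "\<omega> \<in> E b"
        show "\<omega> \<in> G n (b + e) \<union> A n e"
        proof (cases "\<omega> \<in> A n e")
          case False
          have \<omega>M: "\<omega> \<in> space M" using \<omega> by (simp add: E_def)
          have "(SUP s\<in>{0..t}. down_path c1 c2 (\<lambda>s. N s \<omega>) s) \<le> b" using \<omega> by (simp add: E_def)
          from walk_below_of_sup_le[OF pos(1,2) conjunct2[OF path[OF \<omega>M]] conjunct1[OF path[OF \<omega>M]] pos(4) zero_less_Suc this err[OF \<omega>M False]]
          show ?thesis using \<omega>M by (simp only: G_def mem_Collect_eq simp_thms Un_iff)
        qed simp
      qed
      then have "prob (E b) \<le> prob (G n (b + e) \<union> A n e)"
        using G_ev A_ev by (intro finite_measure_mono) auto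
      also have "\<dots> \<le> prob (G n (b + e)) + prob (A n e)"
        by (rule measure_Un_le[OF G_ev A_ev])
      finally show ?thesis .
    qed
    moreover have "(\<lambda>n. prob (G n (b + e)) + prob (A n e)) \<longlonglongrightarrow> F (b + e) + 0"
      using that by (intro tendsto_add G_lim A_lim) auto
    ultimately show ?thesis by (intro LIMSEQ_le_const[where a = "prob (E b)"]) auto
  qed
  have lower: "F b \<le> prob (E (b + e))" if "b \<ge> 0" "e > 0" for b e
  proof -
    have "prob (G n b) \<le> prob (E (b + e)) + prob (A n e)" for n
    proof -
      have "G n b \<subseteq> E (b + e) \<union> A n e"
      proof
        fix \<omega> assume \<omega>: "\<omega> \<in> G n b"
        show "\<omega> \<in> E (b + e) \<union> A n e"
        proof (cases "\<omega> \<in> A n e")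
          case False
          have \<omega>M: "\<omega> \<in> space M" using \<omega> by (simp add: G_def)
          have "walk_below c1 c2 (?h n) (Suc n) False b
              (\<lambda>l. N (real (Suc l) * ?h n) \<omega> - N (real l * ?h n) \<omega>)"
            using \<omega> by (simp only: G_def mem_Collect_eq)
          from sup_le_of_walk_below[OF pos(1,2) conjunct2[OF path[OF \<omega>M]] conjunct1[OF path[OF \<omega>M]] pos(4) zero_less_Suc this err[OF \<omega>M False]]
          show ?thesis using \<omega>M by (simp add: E_def)
        qed simp
      qed
      then have "prob (G n b) \<le> prob (E (b + e) \<union> A n e)"
        using E_ev A_ev by (intro finite_measure_mono) auto
      also have "\<dots> \<le> prob (E (b + e)) + prob (A n e)"
        by (rule measure_Un_le[OF E_ev A_ev])
      finally show ?thesis .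
    qed
    moreover have "(\<lambda>n. prob (E (b + e)) + prob (A n e)) \<longlonglongrightarrow> prob (E (b + e)) + 0"
      using that by (intro tendsto_add A_lim tendsto_const) auto
    ultimately have "F b \<le> prob (E (b + e)) + 0"
      by (intro LIMSEQ_le[OF G_lim[OF that(1)]]) auto
    then show ?thesis by simp
  qed
  have inv0: "(\<lambda>n. 1 / real (Suc n)) \<longlonglongrightarrow> 0" by (intro LIMSEQ_Suc[OF lim_const_over_n])
  have "F \<beta> \<le> prob (E \<beta>)"
  proof -
    have "decseq (\<lambda>n. E (\<beta> + 1 / real (Suc n)))"
    proof (rule decseq_SucI, rule subsetI)
      fix n \<omega> assume \<omega>: "\<omega> \<in> E (\<beta> + 1 / real (Suc (Suc n)))"
      have "\<beta> + 1 / real (Suc (Suc n)) \<le> \<beta> + 1 / real (Suc n)" by (simp add: field_simps)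
      with \<omega> show "\<omega> \<in> E (\<beta> + 1 / real (Suc n))" unfolding E_def by (auto intro: order_trans)
    qed
    then have "(\<lambda>n. prob (E (\<beta> + 1 / real (Suc n)))) \<longlonglongrightarrow> prob (\<Inter>n. E (\<beta> + 1 / real (Suc n)))"
      using E_ev by (intro finite_Lim_measure_decseq) auto
    also have "(\<Inter>n. E (\<beta> + 1 / real (Suc n))) = E \<beta>"
    proof (rule set_eqI)
      fix \<omega>
      let ?S = "SUP s\<in>{0..t}. down_path c1 c2 (\<lambda>s. N s \<omega>) s"
      have "(\<forall>n. ?S \<le> \<beta> + 1 / real (Suc n)) \<longleftrightarrow> ?S \<le> \<beta>"
      proof
        assume "\<forall>n. ?S \<le> \<beta> + 1 / real (Suc n)"
        moreover have "(\<lambda>n. \<beta> + 1 / real (Suc n)) \<longlonglongrightarrow> \<beta> + 0"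
          by (intro tendsto_add tendsto_const inv0)
        ultimately show "?S \<le> \<beta>" by (intro LIMSEQ_le_const[where a = ?S]) auto
      qed (auto intro: add_increasing2)
      then show "\<omega> \<in> (\<Inter>n. E (\<beta> + 1 / real (Suc n))) \<longleftrightarrow> \<omega> \<in> E \<beta>"
        unfolding E_def by blast
    qed
    finally show ?thesis
      by (rule LIMSEQ_le_const) (use lower[OF \<beta>] in auto)
  qed
  moreover have "prob (E \<beta>) \<le> F \<beta>"
  proof -
    have \<rho>: "c2 / c1 \<ge> 0" using pos by simp
    have "(\<lambda>n. \<beta> + 1 / real (Suc n)) \<longlonglongrightarrow> \<beta> + 0"
      by (intro tendsto_add tendsto_const inv0)
    then have s: "(\<lambda>n. \<beta> + 1 / real (Suc n)) \<longlonglongrightarrow> \<beta>" by simp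
    have "(\<lambda>n. F (\<beta> + 1 / real (Suc n))) \<longlonglongrightarrow> F \<beta>"
      unfolding F_def down_prob_def
      by (intro poisson_mean_tendsto exp_bounded_down_weight \<rho> tendsto_intros s)
        (use pos \<beta> in auto)
    then show ?thesis
      by (rule LIMSEQ_le_const) (use upper[OF \<beta>] in auto)
  qed
  ultimately show ?thesis unfolding E_def F_def by simp
qed

section \<open>Rewriting the law with Bessel functions\<close>

text \<open>
  Stated for \<open>x \<le> a\<close> to treat the endpoint and the interior points uniformly.
\<close>

lemma left_limit_at_eq:
  assumes l: "l < x" and x: "x \<le> a"
    and eq: "\<And>y. l < y \<Longrightarrow> y < a \<Longrightarrow> f y = g y" and lim: "(g \<longlongrightarrow> g a) (at_left a)"
  shows "left_limit_at a f x = g x"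
proof (cases "x = a")
  case True
  then have "\<forall>\<^sub>F y in at_left a. f y = g y"
    using l by (auto simp: eventually_at_left_field intro!: exI[of _ l] eq)
  then have "(f \<longlongrightarrow> g a) (at_left a)"
    using lim by (simp add: tendsto_cong)
  then show ?thesis using True by (simp add: left_limit_at_def tendsto_Lim)
qed (use assms in \<open>simp add: left_limit_at_def\<close>)

text \<open>
  The quotients under the square roots are \<open>b / a\<close> and \<open>a / b\<close>, and the Bessel argument is
  \<open>2 * sqrt (a * b)\<close>. As a diagonal series each term is continuous up to \<open>a = 0\<close>, so the prescribed limit at
  \<open>\<beta> = c1 t\<close> is its value there.
\<close>

lemma down_prob_eq_bessel_series:
  assumes pos: "c1 > 0" "c2 > 0" "lam > 0" "t > 0" and \<beta>: "\<beta> \<in> {0..c1 * t}"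
  shows "down_prob (c2 / c1) (lam * (c1 * t - \<beta>) / (c1 + c2)) (lam * (c2 * t + \<beta>) / (c1 + c2)) =
    exp (- lam * t) *
     ((\<Sum>r. left_limit_at (c1 * t)
          (\<lambda>b. bessel_I r (2 * lam / (c1 + c2) * sqrt ((c1 * t - b) * (c2 * t + b))) *
               sqrt ((c2 * t + b) / (c1 * t - b)) ^ r) \<beta>) -
      (\<Sum>k. let r = k + 2 in left_limit_at (c1 * t)
          (\<lambda>b. bessel_I r (2 * lam / (c1 + c2) * sqrt ((c1 * t - b) * (c2 * t + b))) *
               (c2 / c1) ^ (r - 1) *
               sqrt ((c1 * t - b) / (c2 * t + b)) ^ r) \<beta>))"
proof -
  define a where "a y = lam * (c1 * t - y) / (c1 + c2)" for y
  define b where "b y = lam * (c2 * t + y) / (c1 + c2)" for y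
  have ab_pos: "0 < a y" "0 < b y" if "- (c2 * t) < y" "y < c1 * t" for y
    using that pos by (auto simp: a_def b_def)
  have arg: "2 * lam / (c1 + c2) * sqrt ((c1 * t - y) * (c2 * t + y)) = 2 * sqrt (a y * b y)" for y
  proof -
    have "a y * b y = (lam / (c1 + c2))\<^sup>2 * ((c1 * t - y) * (c2 * t + y))"
      by (simp add: a_def b_def power2_eq_square)
    then have "sqrt (a y * b y) = lam / (c1 + c2) * sqrt ((c1 * t - y) * (c2 * t + y))"
      using pos by (simp only: real_sqrt_mult real_sqrt_abs) simp
    then show ?thesis by simp
  qed
  have ratio: "(c2 * t + y) / (c1 * t - y) = b y / a y" "(c1 * t - y) / (c2 * t + y) = a y / b y" for y
    using pos by (simp_all add: a_def b_def)
  have sum: "a \<beta> + b \<beta> = lam * t"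
    using pos by (simp add: a_def b_def add_divide_distrib[symmetric] divide_simps) (simp add: algebra_simps)
  have ends: "- (c2 * t) < \<beta>" "\<beta> \<le> c1 * t" "- (c2 * t) < c1 * t" "0 < c2 * t"
    using \<beta> mult_pos_pos[OF pos(1,4)] mult_pos_pos[OF pos(2,4)] by auto
  have lim: "(a \<longlongrightarrow> a (c1 * t)) (at_left (c1 * t))" "(b \<longlongrightarrow> b (c1 * t)) (at_left (c1 * t))"
    unfolding a_def b_def by (intro tendsto_intros; use pos in simp)+
  have ev: "\<forall>\<^sub>F y in at_left (c1 * t). 0 \<le> a y" "\<forall>\<^sub>F y in at_left (c1 * t). 0 \<le> b y"
    using ab_pos ends(3) by (force simp: eventually_at_left_field intro!: exI[of _ "- (c2 * t)"])+
  have end0: "0 \<le> a (c1 * t)" "0 \<le> b (c1 * t)"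
    using pos by (simp_all add: a_def b_def)
  have 1: "left_limit_at (c1 * t)
      (\<lambda>y. bessel_I r (2 * lam / (c1 + c2) * sqrt ((c1 * t - y) * (c2 * t + y))) *
               sqrt ((c2 * t + y) / (c1 * t - y)) ^ r) \<beta> = diag_series r (a \<beta>) (b \<beta>)" for r
    by (rule left_limit_at_eq[OF ends(1,2), where g = "\<lambda>y. diag_series r (a y) (b y)"])
      (simp_all only: arg ratio bessel_I_eq_diag_series ab_pos diag_series_tendsto lim ev end0)
  have 2: "left_limit_at (c1 * t)
      (\<lambda>y. bessel_I r (2 * lam / (c1 + c2) * sqrt ((c1 * t - y) * (c2 * t + y))) *
               (c2 / c1) ^ (r - 1) * sqrt ((c1 * t - y) / (c2 * t + y)) ^ r) \<beta> =
      (c2 / c1) ^ (r - 1) * diag_series r (b \<beta>) (a \<beta>)" for r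
  proof (rule left_limit_at_eq[OF ends(1,2), where g = "\<lambda>y. (c2 / c1) ^ (r - 1) * diag_series r (b y) (a y)"])
    fix y assume y: "- (c2 * t) < y" "y < c1 * t"
    from bessel_I_eq_diag_series[OF ab_pos(2,1)[OF y], of r]
    have "bessel_I r (2 * sqrt (a y * b y)) * sqrt (a y / b y) ^ r = diag_series r (b y) (a y)"
      by (simp only: mult.commute[of "b y"])
    then show "bessel_I r (2 * lam / (c1 + c2) * sqrt ((c1 * t - y) * (c2 * t + y))) *
               (c2 / c1) ^ (r - 1) * sqrt ((c1 * t - y) / (c2 * t + y)) ^ r =
        (c2 / c1) ^ (r - 1) * diag_series r (b y) (a y)"
      unfolding arg ratio by (metis mult.assoc mult.commute)
  qed (intro tendsto_mult tendsto_const diag_series_tendsto lim ev end0)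
  have "c2 / c1 \<ge> 0" using pos by simp
  then have "down_prob (c2 / c1) (a \<beta>) (b \<beta>) = exp (- lam * t) *
      ((\<Sum>r. diag_series r (a \<beta>) (b \<beta>)) - (\<Sum>k. (c2 / c1) ^ (k + 1) * diag_series (k + 2) (b \<beta>) (a \<beta>)))"
    unfolding down_prob_def poisson_mean_def sum by (simp add: egf2_down_weight)
  then show ?thesis unfolding 1 2 Let_def by (simp add: a_def b_def)
qed

lemma switch_funpow:
  assumes "c1 > 0" "c2 > 0"
  shows "(switch c1 c2 ^^ k) (- c2) = (if odd k then c1 else - c2)"
  using assms by (induction k) (auto simp: switch_def)

text \<open>
  The starting velocity is independent of the sigma-algebra generated by \<open>N\<close>, so conditioning on it
  leaves the probability of an event in that sigma-algebra unchanged.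
\<close>

theorem theorem3p3:
  fixes M :: "'a measure"
    and N :: "real \<Rightarrow> 'a \<Rightarrow> nat"
    and V0 :: "'a \<Rightarrow> real"
    and c1 c2 lam t \<beta> :: real
  assumes "asymmetric_telegraph M c1 c2 lam N V0"
    and "t > 0"
    and "\<beta> \<in> {0..c1 * t}"
  shows "\<P>(\<omega> in M. (SUP s\<in>{0..t}. position c1 c2 N V0 s \<omega>) \<le> \<beta> \<bar> velocity c1 c2 N V0 0 \<omega> = - c2) =
    exp (- lam * t) *
     ((\<Sum>r. left_limit_at (c1 * t)
          (\<lambda>b. bessel_I r (2 * lam / (c1 + c2) * sqrt ((c1 * t - b) * (c2 * t + b))) *
               sqrt ((c2 * t + b) / (c1 * t - b)) ^ r) \<beta>) -
      (\<Sum>k. let r = k + 2 in left_limit_at (c1 * t)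
          (\<lambda>b. bessel_I r (2 * lam / (c1 + c2) * sqrt ((c1 * t - b) * (c2 * t + b))) *
               (c2 / c1) ^ (r - 1) *
               sqrt ((c1 * t - b) / (c2 * t + b)) ^ r) \<beta>))"
proof -
  have M: "prob_space M" and pos: "c1 > 0" "c2 > 0" "lam > 0"
    and PP: "poisson_process M lam N"
    and half: "\<P>(\<omega> in M. V0 \<omega> = - c2) = 1 / 2"
    and indep: "prob_space.indep_set M
       (sets (vimage_algebra (space M) V0 borel))
       (sets (vimage_algebra (space M) (\<lambda>\<omega>. \<lambda>s\<in>{0..}. N s \<omega>) (Pi\<^sub>M {0..} (\<lambda>_. count_space UNIV))))"
    using assms(1) unfolding asymmetric_telegraph_def by simp_all
  interpret prob_space M by (rule M)
  have path: "N 0 \<omega> = 0 \<and> mono_on {0..} (\<lambda>s. N s \<omega>)" if "\<omega> \<in> space M" for \<omega>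
    using PP that unfolding poisson_process_def by simp
  let ?S = "vimage_algebra (space M) (\<lambda>\<omega>. \<lambda>s\<in>{0..}. N s \<omega>) (Pi\<^sub>M {0..} (\<lambda>_. count_space UNIV))"
  let ?E = "{\<omega>\<in>space M. (SUP s\<in>{0..t}. down_path c1 c2 (\<lambda>s. N s \<omega>) s) \<le> \<beta>}"
  let ?D = "{\<omega>\<in>space M. V0 \<omega> = - c2}"
  have N_S: "N s \<in> measurable ?S (count_space UNIV)" if "s \<ge> 0" for s
  proof -
    have "(\<lambda>\<omega>. \<lambda>s\<in>{0..}. N s \<omega>) \<in> measurable ?S (Pi\<^sub>M {0..} (\<lambda>_. count_space UNIV))"
      by (rule measurable_vimage_algebra1) (auto simp: space_PiM)
    from measurable_compose[OF this measurable_component_singleton[of s]]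
    show ?thesis using that by simp
  qed
  have "{\<omega>\<in>space ?S. (SUP s\<in>{0..t}. down_path c1 c2 (\<lambda>s. N s \<omega>) s) \<le> \<beta>} \<in> sets ?S"
    by (rule sup_down_path_measurable[OF N_S]) (use path pos assms(2) in auto)
  then have E: "?E \<in> sets ?S" by simp
  have "V0 -` {- c2} \<inter> space M \<in> sets (vimage_algebra (space M) V0 borel)"
    by (rule in_vimage_algebra) simp
  also have "V0 -` {- c2} \<inter> space M = ?D" by auto
  finally have D: "?D \<in> sets (vimage_algebra (space M) V0 borel)" .
  have vel0: "velocity c1 c2 N V0 0 \<omega> = V0 \<omega>" if "\<omega> \<in> space M" for \<omega>
    using path[OF that] by (simp add: velocity_def)
  have pos_eq: "position c1 c2 N V0 s \<omega> = down_path c1 c2 (\<lambda>s. N s \<omega>) s" if "V0 \<omega> = - c2" for s \<omega>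
    unfolding position_def down_path_def velocity_def that switch_funpow[OF pos(1,2)] ..
  have "{\<omega>\<in>space M. (SUP s\<in>{0..t}. position c1 c2 N V0 s \<omega>) \<le> \<beta> \<and> velocity c1 c2 N V0 0 \<omega> = - c2} = ?D \<inter> ?E"
    using vel0 pos_eq by (auto simp: image_def)
  moreover have "{\<omega>\<in>space M. velocity c1 c2 N V0 0 \<omega> = - c2} = ?D"
    using vel0 by auto
  moreover have "prob (?D \<inter> ?E) = prob ?D * prob ?E"
    by (rule indep_setD[OF indep D E])
  ultimately have "\<P>(\<omega> in M. (SUP s\<in>{0..t}. position c1 c2 N V0 s \<omega>) \<le> \<beta> \<bar> velocity c1 c2 N V0 0 \<omega> = - c2) = prob ?E"
    by (simp only: cond_prob_def half) simp
  also have "\<dots> = down_prob (c2 / c1) (max 0 (lam * (c1 * t - \<beta>) / (c1 + c2))) (lam * (c2 * t + \<beta>) / (c1 + c2))"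
    using prob_sup_down_path_le[OF PP pos assms(2)] assms(3) by simp
  also have "max 0 (lam * (c1 * t - \<beta>) / (c1 + c2)) = lam * (c1 * t - \<beta>) / (c1 + c2)"
    using pos assms(3) by simp
  finally show ?thesis
    unfolding down_prob_eq_bessel_series[OF pos assms(2,3)] .
qed

end
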